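(* Let $X$ be a Banach space with a (Schauder) basis $(e_n)_{n\in\omega}$, and let $b(X)$ be the Polish space of block-bases of $X$ described in the context. Consider the following subsets of $b(X)^2$: $$\mathrm{Is}=\{(y,z)\in b(X)^2:\ \overline{\mathrm{span}}\,y\simeq\overline{\mathrm{span}}\,z\},$$ $$\mathrm{Be}=\{(y,z)\in b(X)^2:\ \overline{\mathrm{span}}\,y\sqsubseteq\overline{\mathrm{span}}\,z\ \text{ and }\ \overline{\mathrm{span}}\,z\sqsubseteq\overline{\mathrm{span}}\,y\},$$ $$\mathrm{Emb}=\{(y,z)\in b(X)^2:\ \overline{\mathrm{span}}\,y\sqsubseteq\overline{\mathrm{span}}\,z\}.$$ Then each of the relations $\mathrm{Is}$, $\mathrm{Be}$ and $\mathrm{Emb}$ is either meager or comeager in the Polish space $b(X)^2$.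
   Context: $\omega=\mathbb{N}=\{0,1,2,\dots\}$. For Banach spaces $V,W$: $V\simeq W$ means that $V$ and $W$ are linearly isomorphic, and $V\sqsubseteq W$ means that $V$ embeds isomorphically into $W$ (is linearly isomorphic to a closed subspace of $W$). The space $b(X)$: given a field $Q$ of scalars, $c_{00}(Q)$ is the $Q$-vector space generated by the basis $(e_n)$ (finite linear combinations of the $e_n$ with coefficients in $Q$). Fix a countable field $Q$ of scalars containing $\mathbb{Q}$ (or $\mathbb{Q}+i\mathbb{Q}$ in the complex case) and containing the norm of every vector of $c_{00}(Q)$. Let $Q_0$ be the set of vectors of norm $1$ in $c_{00}(Q)$, with the discrete topology. The support of $x=\sum_n x_ne_n\in Q_0$ is $\mathrm{supp}\,x=\{n:x_n\neq0\}$. A block-basis made of vectors of $Q_0$ is an infinite sequence $(z_k)_{k\in\omega}$ in $Q_0$ with $\max\mathrm{supp}\,z_k<\min\mathrm{supp}\,z_{k+1}$ for all $k$. The set $b(X)$ of all such block-bases is a closed subset of $Q_0^{\omega}$ (product topology), hence a Polish space. For $z=(z_k)_k\in b(X)$, $\overline{\mathrm{span}}\,z$ is the closed linear span of $\{z_k:k\in\omega\}$ in $X$. *)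

theory Defs
  imports "HOL-Analysis.Analysis" "HOL-Library.Poly_Mapping"
begin

text \<open>
  The scalar multiplication is an explicit parameter \<open>smul\<close>, so that the same definitions
  serve real Banach spaces (\<open>smul = scaleR\<close>) and complex ones. A complex Banach space is a type
  of class \<open>banach\<close> (which provides the complete norm) with a complex scalar multiplication that is
  compatible with the norm and extends the real one.
\<close>

definition complex_banach :: "(complex \<Rightarrow> 'a::banach \<Rightarrow> 'a) \<Rightarrow> bool" where
  "complex_banach smul \<longleftrightarrow>
     vector_space smul \<and>
     (\<forall>c x. norm (smul c x) = norm c * norm x) \<and>
     (\<forall>r x. smul (complex_of_real r) x = r *\<^sub>R x)"

definition schauder_basis ::
  "('k::real_normed_field \<Rightarrow> 'a::banach \<Rightarrow> 'a) \<Rightarrow> (nat \<Rightarrow> 'a) \<Rightarrow> bool" where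
  "schauder_basis smul e \<longleftrightarrow> (\<forall>x. \<exists>!a. (\<lambda>n. smul (a n) (e n)) sums x)"

text \<open>
  A vector of \<open>c\<^sub>0\<^sub>0(Q)\<close> is given by its finitely supported sequence of coefficients, so
  \<^const>\<open>Poly_Mapping.keys\<close> is the support; \<open>vector_of smul e x\<close> is the vector of \<open>X\<close> that it denotes.
\<close>

definition c00 :: "'k::zero set \<Rightarrow> (nat \<Rightarrow>\<^sub>0 'k) set" where
  "c00 Q = {x. \<forall>n. Poly_Mapping.lookup x n \<in> Q}"

definition vector_of :: "('k::zero \<Rightarrow> 'a::comm_monoid_add \<Rightarrow> 'a) \<Rightarrow> (nat \<Rightarrow> 'a) \<Rightarrow> (nat \<Rightarrow>\<^sub>0 'k) \<Rightarrow> 'a" where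
  "vector_of smul e x = (\<Sum>n\<in>Poly_Mapping.keys x. smul (Poly_Mapping.lookup x n) (e n))"

text \<open>In the complex case one requires in addition \<open>\<i> \<in> Q\<close>, i.e. that \<open>Q\<close> contains \<open>\<rat> + \<i>\<rat>\<close>.\<close>

definition admissible_field ::
  "('k::real_normed_field \<Rightarrow> 'a::banach \<Rightarrow> 'a) \<Rightarrow> (nat \<Rightarrow> 'a) \<Rightarrow> 'k set \<Rightarrow> bool" where
  "admissible_field smul e Q \<longleftrightarrow>
     countable Q \<and> \<rat> \<subseteq> Q \<and>
     (\<forall>a\<in>Q. \<forall>b\<in>Q. a + b \<in> Q \<and> a * b \<in> Q) \<and>
     (\<forall>a\<in>Q. - a \<in> Q \<and> inverse a \<in> Q) \<and>
     (\<forall>x\<in>c00 Q. of_real (norm (vector_of smul e x)) \<in> Q)"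

definition Q0 ::
  "('k::real_normed_field \<Rightarrow> 'a::banach \<Rightarrow> 'a) \<Rightarrow> (nat \<Rightarrow> 'a) \<Rightarrow> 'k set \<Rightarrow> (nat \<Rightarrow>\<^sub>0 'k) set" where
  "Q0 smul e Q = {x \<in> c00 Q. norm (vector_of smul e x) = 1}"

definition block_bases ::
  "('k::real_normed_field \<Rightarrow> 'a::banach \<Rightarrow> 'a) \<Rightarrow> (nat \<Rightarrow> 'a) \<Rightarrow> 'k set \<Rightarrow> (nat \<Rightarrow> (nat \<Rightarrow>\<^sub>0 'k)) set" where
  "block_bases smul e Q =
     {z. (\<forall>k. z k \<in> Q0 smul e Q) \<and>
         (\<forall>k. Max (Poly_Mapping.keys (z k)) < Min (Poly_Mapping.keys (z (Suc k))))}"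

definition block_topology ::
  "('k::real_normed_field \<Rightarrow> 'a::banach \<Rightarrow> 'a) \<Rightarrow> (nat \<Rightarrow> 'a) \<Rightarrow> 'k set
    \<Rightarrow> (nat \<Rightarrow> (nat \<Rightarrow>\<^sub>0 'k)) topology" where
  "block_topology smul e Q =
     subtopology (product_topology (\<lambda>_. discrete_topology (Q0 smul e Q)) UNIV) (block_bases smul e Q)"

definition closed_span ::
  "('k::real_normed_field \<Rightarrow> 'a::banach \<Rightarrow> 'a) \<Rightarrow> (nat \<Rightarrow> 'a) \<Rightarrow> (nat \<Rightarrow> (nat \<Rightarrow>\<^sub>0 'k)) \<Rightarrow> 'a set" where
  "closed_span smul e z = closure (module.span smul (range (\<lambda>k. vector_of smul e (z k))))"

text \<open>Isomorphisms are those of Banach spaces: linear homeomorphisms.\<close>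

definition isomorphic_subspaces ::
  "('k::real_normed_field \<Rightarrow> 'a::banach \<Rightarrow> 'a) \<Rightarrow> 'a set \<Rightarrow> 'a set \<Rightarrow> bool" where
  "isomorphic_subspaces smul V W \<longleftrightarrow>
     (\<exists>T S. homeomorphism V W T S \<and>
            (\<forall>x\<in>V. \<forall>y\<in>V. T (x + y) = T x + T y) \<and>
            (\<forall>c. \<forall>x\<in>V. T (smul c x) = smul c (T x)))"

definition embeds ::
  "('k::real_normed_field \<Rightarrow> 'a::banach \<Rightarrow> 'a) \<Rightarrow> 'a set \<Rightarrow> 'a set \<Rightarrow> bool" where
  "embeds smul V W \<longleftrightarrow>
     (\<exists>U. U \<subseteq> W \<and> closed U \<and> module.subspace smul U \<and> isomorphic_subspaces smul V U)"

definition Is_rel ::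
  "('k::real_normed_field \<Rightarrow> 'a::banach \<Rightarrow> 'a) \<Rightarrow> (nat \<Rightarrow> 'a) \<Rightarrow> 'k set
    \<Rightarrow> ((nat \<Rightarrow> (nat \<Rightarrow>\<^sub>0 'k)) \<times> (nat \<Rightarrow> (nat \<Rightarrow>\<^sub>0 'k))) set" where
  "Is_rel smul e Q = {(y, z) \<in> block_bases smul e Q \<times> block_bases smul e Q.
     isomorphic_subspaces smul (closed_span smul e y) (closed_span smul e z)}"

definition Be_rel ::
  "('k::real_normed_field \<Rightarrow> 'a::banach \<Rightarrow> 'a) \<Rightarrow> (nat \<Rightarrow> 'a) \<Rightarrow> 'k set
    \<Rightarrow> ((nat \<Rightarrow> (nat \<Rightarrow>\<^sub>0 'k)) \<times> (nat \<Rightarrow> (nat \<Rightarrow>\<^sub>0 'k))) set" where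
  "Be_rel smul e Q = {(y, z) \<in> block_bases smul e Q \<times> block_bases smul e Q.
     embeds smul (closed_span smul e y) (closed_span smul e z) \<and>
     embeds smul (closed_span smul e z) (closed_span smul e y)}"

definition Emb_rel ::
  "('k::real_normed_field \<Rightarrow> 'a::banach \<Rightarrow> 'a) \<Rightarrow> (nat \<Rightarrow> 'a) \<Rightarrow> 'k set
    \<Rightarrow> ((nat \<Rightarrow> (nat \<Rightarrow>\<^sub>0 'k)) \<times> (nat \<Rightarrow> (nat \<Rightarrow>\<^sub>0 'k))) set" where
  "Emb_rel smul e Q = {(y, z) \<in> block_bases smul e Q \<times> block_bases smul e Q.
     embeds smul (closed_span smul e y) (closed_span smul e z)}"

definition nowhere_dense_in :: "'a topology \<Rightarrow> 'a set \<Rightarrow> bool" where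
  "nowhere_dense_in T A \<longleftrightarrow> A \<subseteq> topspace T \<and> T interior_of (T closure_of A) = {}"

definition meager_in :: "'a topology \<Rightarrow> 'a set \<Rightarrow> bool" where
  "meager_in T A \<longleftrightarrow> (\<exists>\<N>. countable \<N> \<and> (\<forall>N\<in>\<N>. nowhere_dense_in T N) \<and> A = \<Union>\<N>)"

definition comeager_in :: "'a topology \<Rightarrow> 'a set \<Rightarrow> bool" where
  "comeager_in T A \<longleftrightarrow> A \<subseteq> topspace T \<and> meager_in T (topspace T - A)"

end

theory Submission
  imports Defs
begin

text \<open>
  Each of the three relations is a projection. An embedding of the closed span of \<open>y\<close> into that of
  \<open>z\<close> is determined by the images of the vectors \<open>y k\<close>. These images may be moved a little, so they
  can be taken to be finite combinations of the \<open>z j\<close> with coefficients in \<open>Q\<close>; there are only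
  countably many such combinations. That a choice \<open>p\<close> of combinations defines an embedding means
  that, for some constant \<open>C\<close>, the norms of \<open>\<Sum>k. a k * y k\<close> and of its image bound each other up to
  the factor \<open>C\<close>, for every finite sequence \<open>a\<close> over \<open>Q\<close>, and each of these inequalities
  looks at finitely many entries of \<open>y\<close>, \<open>z\<close> and \<open>p\<close>. Hence the relation is the
  projection of a closed subset of the product of the space of pairs with \<open>D\<^sup>\<omega>\<close>, for a countable
  discrete \<open>D\<close>. For isomorphisms one adds the countably many conditions that the image comes close
  to every \<open>z j\<close> (\<open>embeds_iff_coded\<close>, \<open>isomorphic_iff_coded\<close>).

  A projection \<open>A\<close> of this kind is determined up to a meager set by the points that have no
  neighbourhood in which \<open>A\<close> is meager: almost all of these points belong to \<open>A\<close>
  (\<open>meager_category_support_diff_projection\<close>; this is the Baire property of analytic sets).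

  Finally, changing finitely many vectors of a block basis does not change its closed span up to
  isomorphism, so \<open>A\<close> is invariant under such changes. If \<open>A\<close> is not meager, it is nonmeager in every
  open part of some cylinder. Exchanging initial segments of equal length is a homeomorphism between cylinders
  that preserves \<open>A\<close>, and every cylinder contains one that can be reached in this way once both
  initial segments are followed by vectors supported far to the right. So \<open>A\<close> is
  nonmeager near every point and therefore comeager (\<open>zero_one_law\<close>).

  Both the perturbation and the invariance need that the coefficients of a combination of a block
  basis are bounded by its norm. This is Banach's theorem that the coordinate functionals of a
  Schauder basis are continuous (\<open>coef_bounded\<close>), proved with the Baire category theorem.
\<close>

section \<open>Meager sets and projections of closed sets\<close>

lemma nowhere_dense_in_subset:
  assumes "nowhere_dense_in T B" "A \<subseteq> B"
  shows "nowhere_dense_in T A"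
proof -
  have "T interior_of (T closure_of A) \<subseteq> T interior_of (T closure_of B)"
    by (intro interior_of_mono closure_of_mono assms)
  then show ?thesis
    using assms unfolding nowhere_dense_in_def by auto
qed

lemma meager_in_subset:
  assumes "meager_in T B" "A \<subseteq> B"
  shows "meager_in T A"
proof -
  obtain \<N> where \<N>: "countable \<N>" "\<And>N. N \<in> \<N> \<Longrightarrow> nowhere_dense_in T N" "B = \<Union>\<N>"
    using assms(1) unfolding meager_in_def by auto
  have "countable ((\<lambda>N. A \<inter> N) ` \<N>)" "A = \<Union>((\<lambda>N. A \<inter> N) ` \<N>)"
    using \<N> assms(2) by auto
  moreover have "\<forall>M\<in>(\<lambda>N. A \<inter> N) ` \<N>. nowhere_dense_in T M"
    using \<N>(2) by (auto intro: nowhere_dense_in_subset)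
  ultimately show ?thesis
    unfolding meager_in_def by blast
qed

lemma meager_in_UN:
  assumes "countable I" "\<And>i. i \<in> I \<Longrightarrow> meager_in T (A i)"
  shows "meager_in T (\<Union>i\<in>I. A i)"
proof -
  obtain \<N> where \<N>: "\<And>i. i \<in> I \<Longrightarrow>
      countable (\<N> i) \<and> (\<forall>N\<in>\<N> i. nowhere_dense_in T N) \<and> A i = \<Union>(\<N> i)"
    using assms(2) unfolding meager_in_def by metis
  have "countable (\<Union>i\<in>I. \<N> i)"
    using assms(1) \<N> by blast
  moreover have "(\<Union>i\<in>I. A i) = \<Union>(\<Union>i\<in>I. \<N> i)"
    using \<N> by auto
  moreover have "\<forall>N\<in>(\<Union>i\<in>I. \<N> i). nowhere_dense_in T N"
    using \<N> by blast
  ultimately show ?thesis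
    unfolding meager_in_def by (intro exI[of _ "\<Union>i\<in>I. \<N> i"]) simp
qed

lemma meager_in_Un: "meager_in T A \<Longrightarrow> meager_in T B \<Longrightarrow> meager_in T (A \<union> B)"
  using meager_in_UN[of "{A, B}" T "\<lambda>x. x"] by auto

lemma meager_in_nowhere_dense: "nowhere_dense_in T A \<Longrightarrow> meager_in T A"
  unfolding meager_in_def by (intro exI[of _ "{A}"]) auto

lemma meager_in_empty: "meager_in T {}"
  unfolding meager_in_def by (intro exI[of _ "{}"]) auto

lemma nowhere_dense_in_boundary:
  assumes "openin T G"
  shows "nowhere_dense_in T (T closure_of G - G)"
proof -
  have "closedin T (T closure_of G - G)"
    by (simp add: assms closedin_diff)
  moreover have "V = {}" if "openin T V" "V \<subseteq> T closure_of G - G" for V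
  proof -
    have "V \<inter> T closure_of G = {}"
      using that openin_Int_closure_of_eq_empty[of T V G] by blast
    with that show ?thesis by blast
  qed
  then have "T interior_of (T closure_of G - G) = {}"
    by (meson interior_of_subset openin_interior_of)
  ultimately show ?thesis
    unfolding nowhere_dense_in_def
    by (metis closedin_subset closure_of_closedin)
qed

text \<open>
  In a second countable space this closed set contains \<open>A\<close> up to a meager set, and it is the closure of
  its interior.
\<close>

definition category_support :: "'a topology \<Rightarrow> 'a set \<Rightarrow> 'a set" where
  "category_support T A =
     {x \<in> topspace T. \<forall>U. openin T U \<and> x \<in> U \<longrightarrow> \<not> meager_in T (A \<inter> U)}"

text \<open>
  The removed part is covered by the basic open sets in which \<open>A\<close> is meager, and these are countably
  many.
\<close>

lemma meager_outside_category_support: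
  assumes "second_countable T" "A \<subseteq> topspace T"
  shows "meager_in T (A - category_support T A)"
proof -
  obtain \<B> where \<B>: "countable \<B>" "\<And>V. V \<in> \<B> \<Longrightarrow> openin T V"
    "\<And>U x. openin T U \<Longrightarrow> x \<in> U \<Longrightarrow> \<exists>V\<in>\<B>. x \<in> V \<and> V \<subseteq> U"
    using assms(1) unfolding second_countable_def by metis
  let ?\<C> = "{V \<in> \<B>. meager_in T (A \<inter> V)}"
  have "meager_in T (\<Union>V\<in>?\<C>. A \<inter> V)"
    by (intro meager_in_UN) (use \<B> in auto)
  moreover have "A - category_support T A \<subseteq> (\<Union>V\<in>?\<C>. A \<inter> V)"
  proof
    fix x assume x: "x \<in> A - category_support T A"
    then obtain U where U: "openin T U" "x \<in> U" "meager_in T (A \<inter> U)"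
      using assms(2) unfolding category_support_def by blast
    then obtain V where "V \<in> \<B>" "x \<in> V" "V \<subseteq> U"
      using \<B>(3) by blast
    moreover from this U have "meager_in T (A \<inter> V)"
      by (meson Int_mono meager_in_subset order_refl)
    ultimately show "x \<in> (\<Union>V\<in>?\<C>. A \<inter> V)"
      using x by auto
  qed
  ultimately show ?thesis
    by (rule meager_in_subset)
qed

lemma closedin_category_support: "closedin T (category_support T A)"
proof -
  have "topspace T - category_support T A = \<Union>{U. openin T U \<and> meager_in T (A \<inter> U)}"
    unfolding category_support_def using openin_subset[of T] by auto
  moreover have "openin T (\<Union>{U. openin T U \<and> meager_in T (A \<inter> U)})"
    by blast
  ultimately show ?thesis
    by (auto simp: closedin_def category_support_def)
qed

text \<open>
  If the support had no interior in an open set \<open>U\<close>, it would be nowhere dense there, so that \<open>A\<close>, which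
  is almost contained in its support, would be meager in \<open>U\<close>.
\<close>

lemma category_support_subset_closure_of_interior:
  assumes "second_countable T" "A \<subseteq> topspace T"
  shows "category_support T A \<subseteq> T closure_of (T interior_of category_support T A)"
proof
  fix x assume x: "x \<in> category_support T A"
  have "\<exists>y. y \<in> T interior_of category_support T A \<and> y \<in> U" if U: "x \<in> U" "openin T U" for U
  proof (rule ccontr)
    assume none: "\<nexists>y. y \<in> T interior_of category_support T A \<and> y \<in> U"
    let ?V = "T interior_of (T closure_of (category_support T A \<inter> U))"
    have "?V \<subseteq> category_support T A"
      by (meson Int_lower1 closedin_category_support closure_of_minimal interior_of_subset
          order_trans)
    then have "?V \<inter> U \<subseteq> T interior_of category_support T A"
      using U(2) by (intro interior_of_maximal) auto
    \<comment> \<open>An open set contained in the closure of \<open>U\<close> and disjoint from \<open>U\<close> is empty.\<close>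
    then have "?V \<inter> U = {}"
      using none by blast
    then have "?V \<inter> T closure_of U = {}"
      by (simp add: openin_Int_closure_of_eq_empty)
    moreover have "?V \<subseteq> T closure_of U"
      by (meson Int_lower2 closure_of_mono interior_of_subset order_trans)
    ultimately have "nowhere_dense_in T (category_support T A \<inter> U)"
      unfolding nowhere_dense_in_def category_support_def by auto
    then have "meager_in T ((A - category_support T A) \<union> category_support T A \<inter> U)"
      by (intro meager_in_Un meager_outside_category_support meager_in_nowhere_dense assms)
    then have "meager_in T (A \<inter> U)"
      by (rule meager_in_subset) auto
    then show False
      using x U unfolding category_support_def by blast
  qed
  with x show "x \<in> T closure_of (T interior_of category_support T A)"
    unfolding in_closure_of category_support_def by auto
qed

text \<open>
  For a finite sequence \<open>s\<close> let \<open>A s\<close> consist of the points that have a witness starting with \<open>s\<close>; it is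
  the union of the sets \<open>A (s @ [d])\<close>. Up to a nowhere dense set, the support of \<open>A s\<close> is covered
  by the interiors of the supports of the \<open>A (s @ [d])\<close>. A point outside these countably many
  exceptional sets that lies in the support of \<open>A []\<close> therefore lies in the supports along a whole
  branch \<open>\<alpha>\<close>. Then every neighbourhood of \<open>(x, \<alpha>)\<close> meets \<open>F\<close>, and \<open>F\<close> is closed.
\<close>

theorem meager_category_support_diff_projection:
  assumes T: "second_countable T" and D: "countable D"
    and F: "closedin (prod_topology T (product_topology (\<lambda>_::nat. discrete_topology D) UNIV)) F"
  shows "meager_in T (category_support T (fst ` F) - fst ` F)"
proof -
  let ?S = "category_support T"
  define A where "A s = {x. \<exists>\<alpha>. (x, \<alpha>) \<in> F \<and> (\<forall>i<length s. \<alpha> i = s ! i)}" for s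
  define G where "G s = (\<Union>d\<in>D. T interior_of ?S (A (s @ [d])))" for s
  have F_sub: "F \<subseteq> topspace T \<times> (UNIV \<rightarrow>\<^sub>E D)"
    using closedin_subset[OF F] by simp
  have A_sub: "A s \<subseteq> topspace T" for s
    using F_sub unfolding A_def by auto
  have A_split: "A s \<subseteq> (\<Union>d\<in>D. A (s @ [d]))" for s
  proof
    fix x assume "x \<in> A s"
    then obtain \<alpha> where \<alpha>: "(x, \<alpha>) \<in> F" "\<forall>i<length s. \<alpha> i = s ! i"
      unfolding A_def by auto
    have "\<alpha> (length s) \<in> D"
      using \<alpha>(1) F_sub by auto
    moreover have "x \<in> A (s @ [\<alpha> (length s)])"
      unfolding A_def using \<alpha> by (auto simp: nth_append less_Suc_eq)
    ultimately show "x \<in> (\<Union>d\<in>D. A (s @ [d]))" by blast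
  qed
  have G_open: "openin T (G s)" for s
    unfolding G_def by auto
  have G_dense: "?S (A s) \<subseteq> T closure_of (G s)" for s
  proof
    fix x assume x: "x \<in> ?S (A s)"
    have "\<exists>y. y \<in> G s \<and> y \<in> U" if U: "x \<in> U" "openin T U" for U
    proof (rule ccontr)
      assume none: "\<nexists>y. y \<in> G s \<and> y \<in> U"
      have empty: "?S (A (s @ [d])) \<inter> U = {}" if "d \<in> D" for d
      proof -
        have "U \<inter> T interior_of ?S (A (s @ [d])) = {}"
          using none that unfolding G_def by blast
        then have "U \<inter> T closure_of (T interior_of ?S (A (s @ [d]))) = {}"
          using U(2) openin_Int_closure_of_eq_empty by metis
        then show ?thesis
          using category_support_subset_closure_of_interior[OF T A_sub] by blast
      qed
      have "A s \<inter> U \<subseteq> (\<Union>d\<in>D. A (s @ [d]) - ?S (A (s @ [d])))"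
      proof (intro subsetI)
        fix x assume "x \<in> A s \<inter> U"
        then obtain d where "d \<in> D" "x \<in> A (s @ [d])" "x \<in> U"
          using A_split by blast
        then show "x \<in> (\<Union>d\<in>D. A (s @ [d]) - ?S (A (s @ [d])))"
          using empty by blast
      qed
      moreover have "meager_in T (\<Union>d\<in>D. A (s @ [d]) - ?S (A (s @ [d])))"
        by (intro meager_in_UN D meager_outside_category_support T A_sub)
      ultimately have "meager_in T (A s \<inter> U)"
        by (blast intro: meager_in_subset)
      then show False
        using x U unfolding category_support_def by blast
    qed
    with x show "x \<in> T closure_of (G s)"
      unfolding in_closure_of category_support_def by auto
  qed
  have "meager_in T (?S (A s) - G s)" for s
    using meager_in_nowhere_dense[OF nowhere_dense_in_boundary[OF G_open]]
    by (rule meager_in_subset) (use G_dense in blast)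
  then have "meager_in T (\<Union>s\<in>lists D. ?S (A s) - G s)"
    by (intro meager_in_UN) (use D in auto)
  moreover have "?S (A []) - fst ` F \<subseteq> (\<Union>s\<in>lists D. ?S (A s) - G s)"
  proof (rule subsetI, rule ccontr)
    fix x assume x: "x \<in> ?S (A []) - fst ` F"
      and "x \<notin> (\<Union>s\<in>lists D. ?S (A s) - G s)"
    then have "x \<in> G s" if "s \<in> lists D" "x \<in> ?S (A s)" for s
      using that by blast
    then have step: "\<exists>d\<in>D. x \<in> ?S (A (s @ [d]))" if "s \<in> lists D" "x \<in> ?S (A s)" for s
      using that(1) \<open>\<And>s. s \<in> lists D \<Longrightarrow> x \<in> ?S (A s) \<Longrightarrow> x \<in> G s\<close>[OF that]
        interior_of_subset[of T] unfolding G_def by blast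
    have "\<exists>\<sigma>. \<forall>n. (\<sigma> n \<in> lists D \<and> length (\<sigma> n) = n \<and> x \<in> ?S (A (\<sigma> n))) \<and>
        (\<exists>d. \<sigma> (Suc n) = \<sigma> n @ [d])"
    proof (rule dependent_nat_choice)
      show "\<exists>s. s \<in> lists D \<and> length s = 0 \<and> x \<in> ?S (A s)"
        using x by (intro exI[of _ "[]"]) auto
    next
      fix s n assume s: "s \<in> lists D \<and> length s = n \<and> x \<in> ?S (A s)"
      then obtain d where "d \<in> D" "x \<in> ?S (A (s @ [d]))"
        using step by blast
      with s show "\<exists>t. (t \<in> lists D \<and> length t = Suc n \<and> x \<in> ?S (A t)) \<and> (\<exists>d. t = s @ [d])"
        by (intro exI[of _ "s @ [d]"]) auto
    qed
    then obtain \<sigma> where \<sigma>: "\<And>n. \<sigma> n \<in> lists D" "\<And>n. length (\<sigma> n) = n"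
        "\<And>n. x \<in> ?S (A (\<sigma> n))" "\<And>n. \<exists>d. \<sigma> (Suc n) = \<sigma> n @ [d]"
      by blast
    define \<alpha> where "\<alpha> i = \<sigma> (Suc i) ! i" for i
    have \<alpha>: "\<sigma> n ! i = \<alpha> i" if "i < n" for i n
      using that
    proof (induction n)
      case (Suc n)
      obtain d where "\<sigma> (Suc n) = \<sigma> n @ [d]"
        using \<sigma>(4) by blast
      then show ?case
        using Suc \<sigma>(2)[of n] by (cases "i = n") (auto simp: \<alpha>_def nth_append)
    qed simp
    have \<alpha>_D: "\<alpha> \<in> UNIV \<rightarrow>\<^sub>E D"
    proof -
      have "\<alpha> i \<in> set (\<sigma> (Suc i))" for i
        unfolding \<alpha>_def by (rule nth_mem) (simp add: \<sigma>(2))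
      then show ?thesis
        using \<sigma>(1) by auto
    qed
    have "x \<in> topspace T" "(x, \<alpha>) \<notin> F"
      using x by (auto simp: category_support_def image_iff)
    then have "(x, \<alpha>) \<in> topspace T \<times> (UNIV \<rightarrow>\<^sub>E D) - F"
      using \<alpha>_D by blast
    moreover have "openin (prod_topology T (product_topology (\<lambda>_::nat. discrete_topology D) UNIV))
        (topspace T \<times> (UNIV \<rightarrow>\<^sub>E D) - F)"
      using F by (simp add: closedin_def)
    ultimately have "\<exists>U V. openin T U \<and>
        openin (product_topology (\<lambda>_::nat. discrete_topology D) UNIV) V \<and>
        x \<in> U \<and> \<alpha> \<in> V \<and> U \<times> V \<subseteq> topspace T \<times> (UNIV \<rightarrow>\<^sub>E D) - F"
      by (simp only: openin_prod_topology_alt)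
    then obtain U V where UV: "openin T U"
        "openin (product_topology (\<lambda>_::nat. discrete_topology D) UNIV) V"
        "x \<in> U" "\<alpha> \<in> V" "U \<times> V \<subseteq> topspace T \<times> (UNIV \<rightarrow>\<^sub>E D) - F"
      by (elim exE conjE) (rule that)
    obtain X where X: "finite {i. X i \<noteq> D}" "\<alpha> \<in> (\<Pi>\<^sub>E i\<in>UNIV. X i)" "(\<Pi>\<^sub>E i\<in>UNIV. X i) \<subseteq> V"
      using bspec[OF UV(2)[unfolded openin_product_topology_alt] UV(4)] by auto
    obtain n where n: "{i. X i \<noteq> D} \<subseteq> {..<n}"
      using finite_nat_bounded[OF X(1)] by blast
    have "A (\<sigma> n) \<inter> U \<noteq> {}"
    proof
      assume "A (\<sigma> n) \<inter> U = {}"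
      then have "meager_in T (A (\<sigma> n) \<inter> U)"
        by (simp add: meager_in_empty)
      then show False
        using \<sigma>(3)[of n] UV(1,3) unfolding category_support_def by blast
    qed
    then obtain x' \<beta> where \<beta>: "x' \<in> U" "(x', \<beta>) \<in> F" "\<forall>i<n. \<beta> i = \<alpha> i"
      unfolding A_def using \<sigma>(2) \<alpha> by auto
    have "\<beta> i \<in> X i" for i
    proof (cases "i < n")
      case True
      then show ?thesis using \<beta>(3) X(2) by auto
    next
      case False
      then have "X i = D" using n by auto
      then show ?thesis using \<beta>(2) F_sub by auto
    qed
    then have "\<beta> \<in> V" using X(3) by auto
    then show False using UV(5) \<beta> by auto
  qed
  moreover have "A [] = fst ` F"
    unfolding A_def by (auto intro: rev_image_eqI)
  ultimately show ?thesis
    using meager_in_subset by simp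
qed

section \<open>A zero-one law for pairs of sequences\<close>

text \<open>
  A product of discrete spaces has the sets of sequences with a prescribed initial segment as a base.
\<close>

lemma openin_product_discrete_iff:
  "openin (product_topology (\<lambda>_::nat. discrete_topology S) UNIV) U \<longleftrightarrow>
     U \<subseteq> UNIV \<rightarrow> S \<and> (\<forall>x\<in>U. \<exists>n. \<forall>y\<in>UNIV \<rightarrow> S. (\<forall>k<n. y k = x k) \<longrightarrow> y \<in> U)"
  (is "openin ?P U \<longleftrightarrow> ?R")
proof
  assume U: "openin ?P U"
  have sub: "U \<subseteq> UNIV \<rightarrow> S"
    using openin_subset[OF U] by (simp add: PiE_UNIV_domain)
  moreover have "\<exists>n. \<forall>y\<in>UNIV \<rightarrow> S. (\<forall>k<n. y k = x k) \<longrightarrow> y \<in> U" if x: "x \<in> U" for x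
  proof -
    obtain X where X: "finite {i. X i \<noteq> S}" "x \<in> Pi UNIV X" "Pi UNIV X \<subseteq> U"
      using bspec[OF U[unfolded openin_product_topology_alt] x] by (auto simp: PiE_UNIV_domain)
    obtain n where n: "{i. X i \<noteq> S} \<subseteq> {..<n}"
      using finite_nat_bounded[OF X(1)] by blast
    have "y \<in> U" if y: "y \<in> UNIV \<rightarrow> S" "\<forall>k<n. y k = x k" for y
    proof -
      have "y i \<in> X i" for i
        using y X(2) n by (cases "i < n") auto
      then show ?thesis using X(3) by auto
    qed
    then show ?thesis by blast
  qed
  ultimately show ?R by blast
next
  assume R: ?R
  show "openin ?P U"
    unfolding openin_product_topology_alt
  proof
    fix x assume x: "x \<in> U"
    obtain n where n: "\<And>y. y \<in> UNIV \<rightarrow> S \<Longrightarrow> \<forall>k<n. y k = x k \<Longrightarrow> y \<in> U"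
      using bspec[OF conjunct2[OF R] x] by metis
    have xS: "x k \<in> S" for k
      using subsetD[OF conjunct1[OF R] x] by auto
    define X where "X i = (if i < n then {x i} else S)" for i
    have "finite {i. X i \<noteq> S}"
      by (rule finite_subset[of _ "{..<n}"]) (auto simp: X_def)
    moreover have "Pi UNIV X \<subseteq> U"
    proof
      fix y assume y: "y \<in> Pi UNIV X"
      have "y k \<in> S" for k
        using y xS by (cases "k < n") (auto simp: X_def Pi_def split: if_splits)
      moreover have "y k = x k" if "k < n" for k
        using y that by (auto simp: X_def Pi_def split: if_splits)
      ultimately show "y \<in> U"
        by (intro n) auto
    qed
    moreover have "x \<in> Pi UNIV X" "X i \<subseteq> S" for i
      using xS by (auto simp: X_def)
    ultimately show "\<exists>V. finite {i \<in> UNIV. V i \<noteq> topspace (discrete_topology S)} \<and>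
        (\<forall>i\<in>UNIV. openin (discrete_topology S) (V i)) \<and> x \<in> Pi\<^sub>E UNIV V \<and> Pi\<^sub>E UNIV V \<subseteq> U"
      by (intro exI[of _ X]) (auto simp: PiE_UNIV_domain)
  qed
qed

lemma openin_sequence_space_iff:
  assumes "B \<subseteq> UNIV \<rightarrow> S"
  shows "openin (subtopology (product_topology (\<lambda>_::nat. discrete_topology S) UNIV) B) U \<longleftrightarrow>
     U \<subseteq> B \<and> (\<forall>x\<in>U. \<exists>n. \<forall>y\<in>B. (\<forall>k<n. y k = x k) \<longrightarrow> y \<in> U)"
  (is "?L \<longleftrightarrow> ?R")
proof
  assume ?L
  then obtain V where V: "openin (product_topology (\<lambda>_::nat. discrete_topology S) UNIV) V" "U = V \<inter> B"
    unfolding openin_subtopology by blast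
  have "\<exists>n. \<forall>y\<in>B. (\<forall>k<n. y k = x k) \<longrightarrow> y \<in> U" if "x \<in> U" for x
    using V that assms unfolding openin_product_discrete_iff by (metis IntE IntI subsetD)
  then show ?R
    using V(2) by blast
next
  assume R: ?R
  define V where "V = {y \<in> UNIV \<rightarrow> S. \<exists>n. \<forall>z\<in>B. (\<forall>k<n. z k = y k) \<longrightarrow> z \<in> U}"
  have "openin (product_topology (\<lambda>_::nat. discrete_topology S) UNIV) V"
    unfolding openin_product_discrete_iff
  proof (intro conjI ballI)
    show "V \<subseteq> UNIV \<rightarrow> S" by (auto simp: V_def)
    fix y assume "y \<in> V"
    then obtain n where n: "\<forall>z\<in>B. (\<forall>k<n. z k = y k) \<longrightarrow> z \<in> U"
      by (auto simp: V_def)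
    have "z \<in> V" if "z \<in> UNIV \<rightarrow> S" "\<forall>k<n. z k = y k" for z
      using that n unfolding V_def by (intro CollectI conjI exI[of _ n]) simp_all
    then show "\<exists>n. \<forall>z\<in>UNIV \<rightarrow> S. (\<forall>k<n. z k = y k) \<longrightarrow> z \<in> V"
      by blast
  qed
  moreover have "U = V \<inter> B"
  proof
    show "U \<subseteq> V \<inter> B"
      using R assms unfolding V_def by blast
    show "V \<inter> B \<subseteq> U"
      by (auto simp: V_def)
  qed
  ultimately show ?L
    unfolding openin_subtopology by blast
qed

text \<open>
  A point of \<open>(b \<times> b) \<times> D\<^sup>\<omega>\<close> consists of a pair of sequences and a witness; all three are read up to \<open>n\<close>.
\<close>

definition agree :: "nat \<Rightarrow> ((nat \<Rightarrow> 'p) \<times> (nat \<Rightarrow> 'p)) \<times> (nat \<Rightarrow> 'c) \<Rightarrow> _ \<Rightarrow> bool" where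
  "agree n s t \<longleftrightarrow>
     (\<forall>k<n. fst (fst t) k = fst (fst s) k \<and> snd (fst t) k = snd (fst s) k \<and> snd t k = snd s k)"

lemma agree_mono: "agree n s t \<Longrightarrow> m \<le> n \<Longrightarrow> agree m s t"
  by (auto simp: agree_def)

text \<open>
  Continuity into a discrete space, phrased without carriers so that it composes freely.
\<close>

definition locally_determined :: "(((nat \<Rightarrow> 'p) \<times> (nat \<Rightarrow> 'p)) \<times> (nat \<Rightarrow> 'c) \<Rightarrow> 'd) \<Rightarrow> bool" where
  "locally_determined f \<longleftrightarrow> (\<forall>s. \<exists>n. \<forall>t. agree n s t \<longrightarrow> f t = f s)"

text \<open>
  Such predicates define closed sets: a violation is visible on finite initial segments.
\<close>

definition locally_refutable :: "(((nat \<Rightarrow> 'p) \<times> (nat \<Rightarrow> 'p)) \<times> (nat \<Rightarrow> 'c) \<Rightarrow> bool) \<Rightarrow> bool" where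
  "locally_refutable P \<longleftrightarrow> (\<forall>s. \<not> P s \<longrightarrow> (\<exists>n. \<forall>t. agree n s t \<longrightarrow> \<not> P t))"

lemma locally_determined_coordinates:
  "locally_determined (\<lambda>s. fst (fst s) k)"
  "locally_determined (\<lambda>s. snd (fst s) k)"
  "locally_determined (\<lambda>s. snd s k)"
  unfolding locally_determined_def agree_def by (auto intro!: exI[of _ "Suc k"])

lemma locally_determined_const: "locally_determined (\<lambda>s. c)"
  by (simp add: locally_determined_def)

lemma locally_determined_comp: "locally_determined f \<Longrightarrow> locally_determined (\<lambda>s. h (f s))"
  unfolding locally_determined_def by metis

lemma locally_determined_comp2:
  assumes "locally_determined f" "locally_determined g"
  shows "locally_determined (\<lambda>s. h (f s) (g s))"
  unfolding locally_determined_def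
proof
  fix s
  obtain m n where "\<And>t. agree m s t \<Longrightarrow> f t = f s" "\<And>t. agree n s t \<Longrightarrow> g t = g s"
    using assms unfolding locally_determined_def by metis
  then show "\<exists>n. \<forall>t. agree n s t \<longrightarrow> h (f t) (g t) = h (f s) (g s)"
    by (intro exI[of _ "max m n"]) (metis agree_mono max.cobounded1 max.cobounded2)
qed

lemma locally_determined_apply:
  assumes "locally_determined f" "\<And>a. locally_determined (\<lambda>s. g s a)"
  shows "locally_determined (\<lambda>s. g s (f s))"
  unfolding locally_determined_def
proof
  fix s
  obtain m n where "\<And>t. agree m s t \<Longrightarrow> f t = f s" "\<And>t. agree n s t \<Longrightarrow> g t (f s) = g s (f s)"
    using assms unfolding locally_determined_def by metis
  then show "\<exists>n. \<forall>t. agree n s t \<longrightarrow> g t (f t) = g s (f s)"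
    by (intro exI[of _ "max m n"]) (metis agree_mono max.cobounded1 max.cobounded2)
qed

text \<open>
  The finite combination is read first; only its finitely many keys decide which vectors are
  needed.
\<close>

lemma locally_determined_vector_of:
  assumes "\<And>k. locally_determined (\<lambda>s. v s k)" "locally_determined p"
  shows "locally_determined (\<lambda>s. vector_of smul (v s) (p s))"
proof (rule locally_determined_apply[OF assms(2)])
  fix q
  show "locally_determined (\<lambda>s. vector_of smul (v s) q)"
    unfolding locally_determined_def
  proof
    fix s
    have "\<forall>k. \<exists>n. \<forall>t. agree n s t \<longrightarrow> v t k = v s k"
      using assms(1) unfolding locally_determined_def by blast
    then obtain n where n: "\<And>k t. agree (n k) s t \<Longrightarrow> v t k = v s k"
      by metis
    define N where "N = (\<Sum>k\<in>Poly_Mapping.keys q. n k)"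
    have "v t k = v s k" if "agree N s t" "k \<in> Poly_Mapping.keys q" for t k
    proof -
      have "n k \<le> N"
        unfolding N_def using that(2) by (intro member_le_sum) auto
      then show ?thesis
        using n agree_mono[OF that(1)] by blast
    qed
    then have "\<forall>t. agree N s t \<longrightarrow> vector_of smul (v t) q = vector_of smul (v s) q"
      by (auto simp: vector_of_def intro: sum.cong)
    then show "\<exists>n. \<forall>t. agree n s t \<longrightarrow> vector_of smul (v t) q = vector_of smul (v s) q" ..
  qed
qed

lemma locally_refutable_if_determined: "locally_determined P \<Longrightarrow> locally_refutable P"
  unfolding locally_determined_def locally_refutable_def by metis

lemma locally_refutable_all: "(\<And>i. locally_refutable (P i)) \<Longrightarrow> locally_refutable (\<lambda>s. \<forall>i. P i s)"
  unfolding locally_refutable_def by metis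

lemma locally_refutable_ball:
  "(\<And>i. i \<in> I \<Longrightarrow> locally_refutable (P i)) \<Longrightarrow> locally_refutable (\<lambda>s. \<forall>i\<in>I. P i s)"
  unfolding locally_refutable_def by metis

lemma locally_refutable_conj:
  "locally_refutable P \<Longrightarrow> locally_refutable R \<Longrightarrow> locally_refutable (\<lambda>s. P s \<and> R s)"
  unfolding locally_refutable_def by metis

locale sequence_pairs =
  fixes S :: "'p set" and B :: "(nat \<Rightarrow> 'p) set"
  assumes B_S: "B \<subseteq> UNIV \<rightarrow> S" and countable_S: "countable S"
begin

lemma B_nth: "y \<in> B \<Longrightarrow> y k \<in> S"
  using B_S by auto

definition pair_topology :: "((nat \<Rightarrow> 'p) \<times> (nat \<Rightarrow> 'p)) topology" where
  "pair_topology = prod_topology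
     (subtopology (product_topology (\<lambda>_. discrete_topology S) UNIV) B)
     (subtopology (product_topology (\<lambda>_. discrete_topology S) UNIV) B)"

definition cyl :: "nat \<Rightarrow> (nat \<Rightarrow> 'p) \<times> (nat \<Rightarrow> 'p) \<Rightarrow> ((nat \<Rightarrow> 'p) \<times> (nat \<Rightarrow> 'p)) set" where
  "cyl n x = {y \<in> B \<times> B. \<forall>k<n. fst y k = fst x k \<and> snd y k = snd x k}"

lemma topspace_pair: "topspace pair_topology = B \<times> B"
  using B_S by (auto simp: pair_topology_def)

lemma self_in_cyl: "x \<in> B \<times> B \<Longrightarrow> x \<in> cyl n x"
  by (auto simp: cyl_def)

lemma cyl_antimono: "m \<le> n \<Longrightarrow> cyl n x \<subseteq> cyl m x"
  by (auto simp: cyl_def)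

lemma cyl_eq: "y \<in> cyl n x \<Longrightarrow> cyl n y = cyl n x"
  by (auto simp: cyl_def)

lemma openin_pair_iff:
  "openin pair_topology W \<longleftrightarrow> W \<subseteq> B \<times> B \<and> (\<forall>x\<in>W. \<exists>n. cyl n x \<subseteq> W)"
  (is "?L \<longleftrightarrow> ?R")
proof
  assume L: ?L
  have "\<exists>n. cyl n x \<subseteq> W" if "x \<in> W" for x
  proof -
    obtain y z where yz: "x = (y, z)" by force
    obtain U V where UV: "openin (subtopology (product_topology (\<lambda>_. discrete_topology S) UNIV) B) U"
      "openin (subtopology (product_topology (\<lambda>_. discrete_topology S) UNIV) B) V"
      "y \<in> U" "z \<in> V" "U \<times> V \<subseteq> W"
      using L \<open>x \<in> W\<close> unfolding pair_topology_def openin_prod_topology_alt yz by metis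
    then obtain m n where mn: "\<And>a. a \<in> B \<Longrightarrow> \<forall>k<m. a k = y k \<Longrightarrow> a \<in> U"
        "\<And>a. a \<in> B \<Longrightarrow> \<forall>k<n. a k = z k \<Longrightarrow> a \<in> V"
      unfolding openin_sequence_space_iff[OF B_S] by metis
    have "cyl (max m n) x \<subseteq> U \<times> V"
      unfolding cyl_def yz by (auto intro!: mn)
    then show ?thesis
      using UV(5) by blast
  qed
  then show ?R
    using openin_subset[OF L] topspace_pair by simp
next
  assume R: ?R
  show ?L
    unfolding pair_topology_def openin_prod_topology_alt
  proof (intro allI impI)
    fix y z assume yz: "(y, z) \<in> W"
    then obtain n where n: "cyl n (y, z) \<subseteq> W"
      using R by blast
    let ?N = "\<lambda>y. {a \<in> B. \<forall>k<n. a k = y k}"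
    have "openin (subtopology (product_topology (\<lambda>_. discrete_topology S) UNIV) B) (?N y)" for y
      unfolding openin_sequence_space_iff[OF B_S] by (auto intro!: exI[of _ n])
    moreover have "?N y \<times> ?N z \<subseteq> W"
      using n unfolding cyl_def by auto
    moreover have "y \<in> ?N y" "z \<in> ?N z"
      using R yz by auto
    ultimately show "\<exists>U V. openin (subtopology (product_topology (\<lambda>_. discrete_topology S) UNIV) B) U \<and>
        openin (subtopology (product_topology (\<lambda>_. discrete_topology S) UNIV) B) V \<and>
        y \<in> U \<and> z \<in> V \<and> U \<times> V \<subseteq> W"
      by meson
  qed
qed

lemma openin_cyl: "openin pair_topology (cyl n x)"
  unfolding openin_pair_iff
proof (intro conjI ballI)
  show "cyl n x \<subseteq> B \<times> B" by (auto simp: cyl_def)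
  show "\<exists>m. cyl m y \<subseteq> cyl n x" if "y \<in> cyl n x" for y
    using cyl_eq[OF that] by blast
qed

lemma second_countable_pair: "second_countable pair_topology"
  unfolding second_countable_def
proof (intro exI conjI ballI allI impI)
  let ?code = "\<lambda>(s, t). {y \<in> B \<times> B. map (fst y) [0..<length s] = s \<and> map (snd y) [0..<length t] = t}"
  let ?\<B> = "{cyl n x |n x. x \<in> B \<times> B}"
  have "?\<B> \<subseteq> ?code ` (lists S \<times> lists S)"
  proof
    fix C assume "C \<in> ?\<B>"
    then obtain n x where x: "C = cyl n x" "x \<in> B \<times> B" by blast
    have "C = ?code (map (fst x) [0..<n], map (snd x) [0..<n])"
      unfolding x cyl_def by auto
    moreover have "(map (fst x) [0..<n], map (snd x) [0..<n]) \<in> lists S \<times> lists S"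
      using x(2) by (auto simp: mem_Times_iff B_nth)
    ultimately show "C \<in> ?code ` (lists S \<times> lists S)"
      by (rule image_eqI)
  qed
  then show "countable ?\<B>"
    using countable_S by (meson countable_SIGMA countable_image countable_lists countable_subset)
  show "openin pair_topology V" if "V \<in> ?\<B>" for V
    using that openin_cyl by auto
  fix U x assume "openin pair_topology U \<and> x \<in> U"
  then obtain n where "cyl n x \<subseteq> U" "x \<in> B \<times> B"
    unfolding openin_pair_iff by blast
  then show "\<exists>V\<in>?\<B>. x \<in> V \<and> V \<subseteq> U"
    using self_in_cyl by blast
qed

lemma nowhere_dense_in_pair_iff:
  assumes "A \<subseteq> B \<times> B"
  shows "nowhere_dense_in pair_topology A \<longleftrightarrow>
    (\<forall>x\<in>B \<times> B. \<forall>n. \<exists>y\<in>cyl n x. \<exists>m. cyl m y \<inter> A = {})"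
proof
  assume nd: "nowhere_dense_in pair_topology A"
  show "\<forall>x\<in>B \<times> B. \<forall>n. \<exists>y\<in>cyl n x. \<exists>m. cyl m y \<inter> A = {}"
  proof (intro ballI allI)
    fix x n assume x: "x \<in> B \<times> B"
    have "\<not> cyl n x \<subseteq> pair_topology closure_of A"
      using nd self_in_cyl[OF x] interior_of_maximal[OF _ openin_cyl]
      unfolding nowhere_dense_in_def by blast
    then obtain y where y: "y \<in> cyl n x" "y \<notin> pair_topology closure_of A" by blast
    then have "y \<in> topspace pair_topology"
      by (simp add: topspace_pair cyl_def)
    then obtain U where "openin pair_topology U" "y \<in> U" "U \<inter> A = {}"
      using y(2) unfolding in_closure_of by blast
    then obtain m where "cyl m y \<inter> A = {}"
      unfolding openin_pair_iff by blast
    with y(1) show "\<exists>y\<in>cyl n x. \<exists>m. cyl m y \<inter> A = {}" by blast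
  qed
next
  assume R: "\<forall>x\<in>B \<times> B. \<forall>n. \<exists>y\<in>cyl n x. \<exists>m. cyl m y \<inter> A = {}"
  let ?V = "pair_topology interior_of (pair_topology closure_of A)"
  have "x \<notin> ?V" for x
  proof
    assume x: "x \<in> ?V"
    have "openin pair_topology ?V" by simp
    then obtain n where n: "cyl n x \<subseteq> ?V" "x \<in> B \<times> B"
      using x unfolding openin_pair_iff by blast
    then obtain y m where y: "y \<in> cyl n x" "cyl m y \<inter> A = {}"
      using R by blast
    then have "y \<in> pair_topology closure_of A"
      using n(1) interior_of_subset[of pair_topology "pair_topology closure_of A"] by auto
    moreover have "y \<in> cyl m y"
      using y(1) by (auto simp: cyl_def)
    ultimately show False
      using openin_cyl y(2) unfolding in_closure_of by blast
  qed
  then show "nowhere_dense_in pair_topology A"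
    unfolding nowhere_dense_in_def using assms topspace_pair by auto
qed

lemma closedin_locally_refutable:
  assumes "locally_refutable P"
  shows "closedin (prod_topology pair_topology (product_topology (\<lambda>_::nat. discrete_topology D) UNIV))
     {s \<in> (B \<times> B) \<times> (UNIV \<rightarrow> D). P s}"
  unfolding closedin_def
proof
  let ?F = "{s \<in> (B \<times> B) \<times> (UNIV \<rightarrow> D). P s}"
  let ?C = "product_topology (\<lambda>_::nat. discrete_topology D) UNIV"
  let ?T = "prod_topology pair_topology ?C"
  have top: "topspace ?T = (B \<times> B) \<times> (UNIV \<rightarrow> D)"
    by (simp add: topspace_pair PiE_UNIV_domain)
  show "?F \<subseteq> topspace ?T"
    unfolding top by blast
  show "openin ?T (topspace ?T - ?F)"
    unfolding openin_prod_topology_alt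
  proof (intro allI impI)
    fix x \<alpha> assume xa: "(x, \<alpha>) \<in> topspace ?T - ?F"
    then have "\<not> P (x, \<alpha>)"
      unfolding top by blast
    then obtain n where n: "\<And>t. agree n (x, \<alpha>) t \<Longrightarrow> \<not> P t"
      using assms unfolding locally_refutable_def by blast
    let ?V = "{\<beta> \<in> UNIV \<rightarrow> D. \<forall>k<n. \<beta> k = \<alpha> k}"
    have "openin ?C ?V"
      unfolding openin_product_discrete_iff by (auto intro!: exI[of _ n])
    moreover have "x \<in> cyl n x" "\<alpha> \<in> ?V"
      using xa unfolding top by (auto intro: self_in_cyl)
    moreover have "cyl n x \<times> ?V \<subseteq> topspace ?T - ?F"
    proof
      fix t assume t: "t \<in> cyl n x \<times> ?V"
      then have "\<not> P t"
        by (intro n) (auto simp: agree_def cyl_def)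
      then show "t \<in> topspace ?T - ?F"
        using t unfolding top by (auto simp: cyl_def)
    qed
    ultimately show "\<exists>U V. openin pair_topology U \<and> openin ?C V \<and> x \<in> U \<and> \<alpha> \<in> V \<and>
        U \<times> V \<subseteq> topspace ?T - ?F"
      using openin_cyl by meson
  qed
qed

end

text \<open>
  The two properties of block bases used by the zero-one law: an initial segment can be exchanged
  for another one of the same length if the next entry fits both, and any two initial segments of
  the same length have a common continuation.
\<close>

locale graftable_sequence_pairs = sequence_pairs +
  assumes graft_in: "x \<in> B \<Longrightarrow> y \<in> B \<Longrightarrow> x n = y n \<Longrightarrow> (\<lambda>k. if k < n then x k else y k) \<in> B"
    and common_tail: "x \<in> B \<Longrightarrow> y \<in> B \<Longrightarrow>
      \<exists>x'\<in>B. \<exists>y'\<in>B. (\<forall>k<n. x' k = x k \<and> y' k = y k) \<and> (\<forall>k\<ge>n. x' k = y' k)"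
begin

definition graft :: "nat \<Rightarrow> (nat \<Rightarrow> 'a) \<times> (nat \<Rightarrow> 'a) \<Rightarrow> (nat \<Rightarrow> 'a) \<times> (nat \<Rightarrow> 'a) \<Rightarrow> (nat \<Rightarrow> 'a) \<times> (nat \<Rightarrow> 'a)" where
  "graft n x y = (\<lambda>k. if k < n then fst x k else fst y k, \<lambda>k. if k < n then snd x k else snd y k)"

definition same_at :: "nat \<Rightarrow> (nat \<Rightarrow> 'a) \<times> (nat \<Rightarrow> 'a) \<Rightarrow> (nat \<Rightarrow> 'a) \<times> (nat \<Rightarrow> 'a) \<Rightarrow> bool" where
  "same_at k x y \<longleftrightarrow> fst x k = fst y k \<and> snd x k = snd y k"

lemma in_cyl_iff: "y \<in> cyl n x \<longleftrightarrow> y \<in> B \<times> B \<and> (\<forall>k<n. same_at k y x)"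
  by (auto simp: cyl_def same_at_def)

lemma same_at_graft: "same_at k (graft n x y) z \<longleftrightarrow> (if k < n then same_at k x z else same_at k y z)"
  by (simp add: graft_def same_at_def)

lemma same_at_sym: "same_at k x y \<longleftrightarrow> same_at k y x"
  by (auto simp: same_at_def)

lemma same_at_trans: "same_at k x y \<Longrightarrow> same_at k y z \<Longrightarrow> same_at k x z"
  by (auto simp: same_at_def)

lemma graft_in_pair: "x \<in> B \<times> B \<Longrightarrow> y \<in> B \<times> B \<Longrightarrow> same_at n x y \<Longrightarrow> graft n x y \<in> B \<times> B"
  unfolding graft_def same_at_def by (auto intro: graft_in)

lemma graft_in_cyl:
  assumes "x \<in> B \<times> B" "z \<in> B \<times> B" "same_at n x z" "y \<in> cyl (Suc n) z"
  shows "graft n x y \<in> cyl (Suc n) x"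
proof -
  have "same_at n x y"
    using assms(3,4) unfolding in_cyl_iff by (metis lessI same_at_sym same_at_trans)
  then show ?thesis
    using assms(1,4) unfolding in_cyl_iff same_at_graft
    by (auto intro: graft_in_pair simp: same_at_sym less_Suc_eq) (auto simp: same_at_def)
qed

text \<open>
  Exchanging the initial segment maps the cylinder of \<open>z\<close> homeomorphically onto that of \<open>x\<close>. The
  cylinders fix one more entry than is exchanged, because the entry at \<open>n\<close> must fit both initial
  segments.
\<close>

lemma nowhere_dense_graft:
  assumes x: "x \<in> B \<times> B" "z \<in> B \<times> B" "same_at n x z"
    and A: "nowhere_dense_in pair_topology A" "A \<subseteq> B \<times> B"
  shows "nowhere_dense_in pair_topology {s \<in> cyl (Suc n) z. graft n x s \<in> A}"
proof -
  have zx: "same_at n z x"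
    using x(3) same_at_sym by blast
  show ?thesis
  proof (subst nowhere_dense_in_pair_iff)
    show "{s \<in> cyl (Suc n) z. graft n x s \<in> A} \<subseteq> B \<times> B"
      by (auto simp: cyl_def)
    show "\<forall>y\<in>B \<times> B. \<forall>k. \<exists>y'\<in>cyl k y. \<exists>m. cyl m y' \<inter> {s \<in> cyl (Suc n) z. graft n x s \<in> A} = {}"
    proof (intro ballI allI)
      fix y k assume y: "y \<in> B \<times> B"
      show "\<exists>y'\<in>cyl k y. \<exists>m. cyl m y' \<inter> {s \<in> cyl (Suc n) z. graft n x s \<in> A} = {}"
      proof (cases "y \<in> cyl (Suc n) z")
        case False
        then have "cyl (Suc n) y \<inter> cyl (Suc n) z = {}"
          using cyl_eq self_in_cyl[OF y] by blast
        then show ?thesis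
          using self_in_cyl[OF y] by blast
      next
        case True
        let ?w = "graft n x y"
        have w: "?w \<in> cyl (Suc n) x"
          using x True by (intro graft_in_cyl)
        then have "?w \<in> B \<times> B"
          by (simp add: in_cyl_iff)
        then obtain w' m where w': "w' \<in> cyl (max k (Suc n)) ?w" "cyl m w' \<inter> A = {}"
          using A(1)[unfolded nowhere_dense_in_pair_iff[OF A(2)], THEN bspec, THEN spec] by metis
        have w'x: "w' \<in> cyl (Suc n) x"
          using subsetD[OF cyl_antimono w'(1), of "Suc n"] cyl_eq[OF w] by simp
        let ?y = "graft n z w'"
        have y': "?y \<in> cyl (Suc n) z"
          using x zx w'x by (intro graft_in_cyl)
        moreover have "?y \<in> cyl k y"
          unfolding in_cyl_iff same_at_graft
        proof (intro conjI allI impI)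
          show "?y \<in> B \<times> B" using y' by (simp add: in_cyl_iff)
          fix i assume i: "i < k"
          have "same_at i w' ?w"
            using w'(1) i by (simp add: in_cyl_iff)
          then have "same_at i w' y" if "\<not> i < n"
            using that same_at_sym same_at_graft by metis
          moreover have "same_at i z y" if "i < n"
            using True that by (simp add: in_cyl_iff same_at_sym)
          ultimately show "if i < n then same_at i z y else same_at i w' y" by simp
        qed
        moreover have "cyl m ?y \<inter> {s \<in> cyl (Suc n) z. graft n x s \<in> A} = {}"
        proof -
          have "graft n x s \<in> cyl m w'" if s: "s \<in> cyl m ?y" "s \<in> cyl (Suc n) z" for s
            unfolding in_cyl_iff same_at_graft
          proof (intro conjI allI impI)
            show "graft n x s \<in> B \<times> B"
              using graft_in_cyl[OF x s(2)] by (simp add: in_cyl_iff)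
            fix i assume i: "i < m"
            have "same_at i s ?y"
              using s(1) i by (simp add: in_cyl_iff)
            then have "same_at i s w'" if "\<not> i < n"
              using that same_at_sym same_at_graft by metis
            moreover have "same_at i x w'" if "i < n"
              using w'x that by (simp add: in_cyl_iff same_at_sym)
            ultimately show "if i < n then same_at i x w' else same_at i s w'" by simp
          qed
          then show ?thesis
            using w'(2) by auto
        qed
        ultimately show ?thesis by blast
      qed
    qed
  qed
qed

lemma meager_graft:
  assumes "x \<in> B \<times> B" "z \<in> B \<times> B" "same_at n x z" "meager_in pair_topology A"
  shows "meager_in pair_topology {s \<in> cyl (Suc n) z. graft n x s \<in> A}"
proof -
  obtain \<N> where \<N>: "countable \<N>" "\<And>N. N \<in> \<N> \<Longrightarrow> nowhere_dense_in pair_topology N" "A = \<Union>\<N>"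
    using assms(4) unfolding meager_in_def by auto
  have "meager_in pair_topology (\<Union>N\<in>\<N>. {s \<in> cyl (Suc n) z. graft n x s \<in> N})"
  proof (rule meager_in_UN[OF \<N>(1)])
    fix N assume "N \<in> \<N>"
    then have "nowhere_dense_in pair_topology N" "N \<subseteq> B \<times> B"
      using \<N>(2) unfolding nowhere_dense_in_def topspace_pair by auto
    then show "meager_in pair_topology {s \<in> cyl (Suc n) z. graft n x s \<in> N}"
      by (intro meager_in_nowhere_dense nowhere_dense_graft assms)
  qed
  then show ?thesis
    by (rule meager_in_subset) (auto simp: \<N>(3))
qed

lemma common_tail_pair:
  assumes "x \<in> B \<times> B" "y \<in> B \<times> B"
  obtains x' y' where "x' \<in> cyl n x" "y' \<in> cyl n y" "\<And>k. k \<ge> n \<Longrightarrow> same_at k x' y'"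
proof -
  obtain a a' where a: "a \<in> B" "a' \<in> B" "\<forall>k<n. a k = fst x k \<and> a' k = fst y k" "\<forall>k\<ge>n. a k = a' k"
    using common_tail[of "fst x" "fst y" n] assms by (auto simp: mem_Times_iff)
  obtain b b' where b: "b \<in> B" "b' \<in> B" "\<forall>k<n. b k = snd x k \<and> b' k = snd y k" "\<forall>k\<ge>n. b k = b' k"
    using common_tail[of "snd x" "snd y" n] assms by (auto simp: mem_Times_iff)
  show ?thesis
    using a b by (intro that[of "(a, b)" "(a', b')"]) (auto simp: cyl_def same_at_def)
qed

text \<open>
  A nonmeager \<open>A\<close> has a cylinder around \<open>x0\<close> inside its support. Near an arbitrary \<open>x\<close>, a common tail is
  attached to the initial segments of \<open>x0\<close> and \<open>x\<close>. The exchange of these segments preserves \<open>A\<close>, so \<open>A\<close>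
  cannot be meager near \<open>x\<close> without being meager in an open subset of its support. Hence the support
  is the whole space, and the complement of \<open>A\<close> is meager because \<open>A\<close> is a projection.
\<close>

theorem zero_one_law:
  assumes A: "A = fst ` F" and D: "countable D"
    and F: "closedin (prod_topology pair_topology (product_topology (\<lambda>_::nat. discrete_topology D) UNIV)) F"
    and invariant: "\<And>x y n. x \<in> A \<Longrightarrow> y \<in> B \<times> B \<Longrightarrow> (\<And>k. k \<ge> n \<Longrightarrow> same_at k x y) \<Longrightarrow> y \<in> A"
  shows "meager_in pair_topology A \<or> comeager_in pair_topology A"
proof (cases "meager_in pair_topology A")
  case False
  let ?D = "category_support pair_topology A"
  have A_sub: "A \<subseteq> topspace pair_topology"
    using closedin_subset[OF F] A by auto
  have "?D \<noteq> {}"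
  proof
    assume "?D = {}"
    then show False
      using meager_outside_category_support[OF second_countable_pair A_sub] False by simp
  qed
  then have "pair_topology interior_of ?D \<noteq> {}"
    using category_support_subset_closure_of_interior[OF second_countable_pair A_sub] by auto
  then obtain x0 where "x0 \<in> pair_topology interior_of ?D"
    by blast
  moreover have "openin pair_topology (pair_topology interior_of ?D)"
    by simp
  ultimately obtain n0 where n0: "cyl n0 x0 \<subseteq> pair_topology interior_of ?D" "x0 \<in> B \<times> B"
    unfolding openin_pair_iff by blast
  have "x \<in> ?D" if x: "x \<in> B \<times> B" for x
  proof (rule ccontr)
    assume "x \<notin> ?D"
    then obtain U where U: "openin pair_topology U" "x \<in> U" "meager_in pair_topology (A \<inter> U)"
      using x unfolding category_support_def topspace_pair by blast
    then obtain n where n: "cyl n x \<subseteq> U"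
      unfolding openin_pair_iff by blast
    define N where "N = max n0 n"
    \<comment> \<open>\<open>x1\<close> lies in the cylinder of \<open>x0\<close> contained in the support, \<open>x2\<close> near \<open>x\<close>.\<close>
    obtain x1 x2 where x1: "x1 \<in> cyl N x0" and x2: "x2 \<in> cyl N x"
      and tail: "\<And>k. k \<ge> N \<Longrightarrow> same_at k x1 x2"
      using common_tail_pair[OF n0(2) x] by metis
    have "x1 \<in> B \<times> B" "x2 \<in> B \<times> B" "same_at N x2 x1"
      using x1 x2 tail[of N] by (auto simp: in_cyl_iff same_at_sym)
    note grafting = this
    have "cyl (Suc N) x2 \<subseteq> cyl N x2"
      by (intro cyl_antimono) simp
    moreover have "cyl N x \<subseteq> cyl n x"
      by (intro cyl_antimono) (simp add: N_def)
    ultimately have "cyl (Suc N) x2 \<subseteq> U"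
      using n cyl_eq[OF x2] by blast
    then have "meager_in pair_topology (A \<inter> cyl (Suc N) x2)"
      using U(3) meager_in_subset by (metis Int_mono order_refl)
    then have "meager_in pair_topology {s \<in> cyl (Suc N) x1. graft N x2 s \<in> A \<inter> cyl (Suc N) x2}"
      using grafting(2,1,3) by (intro meager_graft)
    moreover have "A \<inter> cyl (Suc N) x1 \<subseteq> {s \<in> cyl (Suc N) x1. graft N x2 s \<in> A \<inter> cyl (Suc N) x2}"
    proof
      fix s assume s: "s \<in> A \<inter> cyl (Suc N) x1"
      then have in2: "graft N x2 s \<in> cyl (Suc N) x2"
        using grafting by (intro graft_in_cyl) auto
      moreover have "graft N x2 s \<in> A"
      proof (rule invariant)
        show "s \<in> A" using s by blast
        show "graft N x2 s \<in> B \<times> B" using in2 by (simp add: in_cyl_iff)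
        show "same_at k s (graft N x2 s)" if "k \<ge> N" for k
          using that by (simp add: same_at_def graft_def)
      qed
      ultimately show "s \<in> {s \<in> cyl (Suc N) x1. graft N x2 s \<in> A \<inter> cyl (Suc N) x2}"
        using s by blast
    qed
    ultimately have "meager_in pair_topology (A \<inter> cyl (Suc N) x1)"
      by (rule meager_in_subset)
    moreover have "x1 \<in> ?D"
    proof -
      have "x1 \<in> cyl n0 x0"
        using x1 cyl_antimono[of n0 N x0] by (auto simp: N_def)
      then show ?thesis
        using n0(1) interior_of_subset[of pair_topology ?D] by auto
    qed
    ultimately show False
      using openin_cyl self_in_cyl[OF grafting(1)] unfolding category_support_def by blast
  qed
  then have "topspace pair_topology - A \<subseteq> ?D - fst ` F"
    unfolding topspace_pair A by blast
  moreover have "meager_in pair_topology (?D - fst ` F)"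
    using meager_category_support_diff_projection[OF second_countable_pair D F] A by simp
  ultimately show ?thesis
    unfolding comeager_in_def using A_sub meager_in_subset by blast
qed simp

end

section \<open>Closed spans and isomorphisms\<close>

lemma vector_of_superset:
  assumes "vector_space smul" "finite A" "Poly_Mapping.keys p \<subseteq> A"
  shows "vector_of smul v p = (\<Sum>n\<in>A. smul (Poly_Mapping.lookup p n) (v n))"
proof -
  interpret vector_space smul by fact
  show ?thesis
    unfolding vector_of_def
    by (rule sum.mono_neutral_left) (use assms in \<open>auto simp: in_keys_iff\<close>)
qed

text \<open>
  Real and complex Banach spaces at once: \<open>'k\<close> is the scalar field and \<open>smul\<close> the scalar multiplication.
\<close>

locale normed_scalars = vector_space smul
  for smul :: "'k::{real_normed_field,banach} \<Rightarrow> 'a::banach \<Rightarrow> 'a" +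
  assumes norm_smul: "norm (smul c x) = norm c * norm x"
    and smul_of_real: "smul (of_real r) x = r *\<^sub>R x"
begin

sublocale smul: bounded_bilinear smul
proof
  fix a a' :: 'k and b b' :: 'a and r :: real
  show "smul (r *\<^sub>R a) b = r *\<^sub>R smul a b"
    by (metis scaleR_conv_of_real scale_scale smul_of_real)
  show "smul a (r *\<^sub>R b) = r *\<^sub>R smul a b"
    by (metis scale_left_commute smul_of_real)
  show "\<exists>K. \<forall>a b. norm (smul a b) \<le> norm a * norm b * K"
    by (intro exI[of _ 1]) (simp add: norm_smul)
qed (simp_all add: scale_left_distrib scale_right_distrib)

lemma subspace_closure:
  assumes "subspace S"
  shows "subspace (closure S)"
proof (rule subspaceI)
  show "0 \<in> closure S"
    using assms closure_subset subspace_0 by blast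
next
  fix x y assume "x \<in> closure S" "y \<in> closure S"
  then obtain a b where "\<forall>n. a n \<in> S" "a \<longlonglongrightarrow> x" "\<forall>n. b n \<in> S" "b \<longlonglongrightarrow> y"
    unfolding closure_sequential by auto
  then show "x + y \<in> closure S"
    unfolding closure_sequential
    by (intro exI[of _ "\<lambda>n. a n + b n"]) (auto intro: tendsto_add subspace_add assms)
next
  fix c x assume "x \<in> closure S"
  then obtain a where "\<forall>n. a n \<in> S" "a \<longlonglongrightarrow> x"
    unfolding closure_sequential by auto
  then show "smul c x \<in> closure S"
    unfolding closure_sequential
    by (intro exI[of _ "\<lambda>n. smul c (a n)"])
      (auto intro: smul.tendsto subspace_scale assms)
qed

abbreviation lincomb :: "(nat \<Rightarrow> 'a) \<Rightarrow> (nat \<Rightarrow>\<^sub>0 'k) \<Rightarrow> 'a" where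
  "lincomb \<equiv> vector_of smul"

lemmas lincomb_superset = vector_of_superset[OF vector_space_axioms]

lemma lincomb_add: "lincomb v (p + q) = lincomb v p + lincomb v q"
proof -
  let ?A = "Poly_Mapping.keys p \<union> Poly_Mapping.keys q"
  have "lincomb v (p + q) = (\<Sum>n\<in>?A. smul (Poly_Mapping.lookup (p + q) n) (v n))"
    by (intro lincomb_superset keys_add) auto
  moreover have "lincomb v p = (\<Sum>n\<in>?A. smul (Poly_Mapping.lookup p n) (v n))"
    "lincomb v q = (\<Sum>n\<in>?A. smul (Poly_Mapping.lookup q n) (v n))"
    by (intro lincomb_superset; auto)+
  ultimately show ?thesis
    by (simp add: lookup_add scale_left_distrib sum.distrib)
qed

lemma lookup_map_mult: "Poly_Mapping.lookup (Poly_Mapping.map ((*) c) p) n = c * Poly_Mapping.lookup p n"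
  for c :: 'k
  by (simp add: map.rep_eq when_def)

lemma lincomb_map_mult: "lincomb v (Poly_Mapping.map ((*) c) p) = smul c (lincomb v p)"
proof -
  have "lincomb v (Poly_Mapping.map ((*) c) p)
      = (\<Sum>n\<in>Poly_Mapping.keys p. smul (Poly_Mapping.lookup (Poly_Mapping.map ((*) c) p) n) (v n))"
    by (intro lincomb_superset) (auto simp: in_keys_iff lookup_map_mult)
  then show ?thesis
    by (simp add: lookup_map_mult vector_of_def scale_sum_right)
qed

lemma lincomb_single: "lincomb v (Poly_Mapping.single n c) = smul c (v n)"
  by (subst lincomb_superset[of "{n}"]) auto

lemma lincomb_diff: "lincomb v (p - q) = lincomb v p - lincomb v q"
proof -
  have "lincomb v p = lincomb v (p - q) + lincomb v q"
    by (simp flip: lincomb_add)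
  then show ?thesis by simp
qed

lemma lincomb_diff_seq: "lincomb (\<lambda>k. v k - w k) p = lincomb v p - lincomb w p"
  by (simp add: vector_of_def scale_right_diff_distrib sum_subtractf)

lemma lincomb_in_subspace: "subspace S \<Longrightarrow> (\<And>k. v k \<in> S) \<Longrightarrow> lincomb v p \<in> S"
  unfolding vector_of_def by (intro subspace_sum subspace_scale)

definition cspan :: "(nat \<Rightarrow> 'a) \<Rightarrow> 'a set" where
  "cspan v = closure (span (range v))"

lemma subspace_cspan: "subspace (cspan v)"
  unfolding cspan_def by (intro subspace_closure subspace_span)

lemma closed_cspan: "closed (cspan v)"
  by (simp add: cspan_def)

lemma in_cspan: "v k \<in> cspan v"
  unfolding cspan_def by (meson closure_subset rangeI span_base subset_iff)

lemma lincomb_in_cspan: "(\<And>k. v k \<in> cspan u) \<Longrightarrow> lincomb v p \<in> cspan u"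
  by (intro lincomb_in_subspace subspace_cspan)

lemma lincomb_in_own_cspan: "lincomb v p \<in> cspan v"
  by (intro lincomb_in_cspan in_cspan)

lemma cspan_minimal: "subspace S \<Longrightarrow> closed S \<Longrightarrow> (\<And>k. v k \<in> S) \<Longrightarrow> cspan v \<subseteq> S"
  unfolding cspan_def by (intro closure_minimal span_minimal) auto

definition linear_map_on :: "'a set \<Rightarrow> ('a \<Rightarrow> 'a) \<Rightarrow> bool" where
  "linear_map_on V T \<longleftrightarrow>
     (\<forall>x\<in>V. \<forall>y\<in>V. T (x + y) = T x + T y) \<and> (\<forall>c. \<forall>x\<in>V. T (smul c x) = smul c (T x))"

lemma linear_map_on_subset: "linear_map_on V T \<Longrightarrow> U \<subseteq> V \<Longrightarrow> linear_map_on U T"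
  unfolding linear_map_on_def by blast

lemma isomorphic_subspaces_iff:
  "isomorphic_subspaces smul V W \<longleftrightarrow> (\<exists>T S. homeomorphism V W T S \<and> linear_map_on V T)"
  unfolding isomorphic_subspaces_def linear_map_on_def ..

lemma linear_map_on_0: "linear_map_on V T \<Longrightarrow> subspace V \<Longrightarrow> T 0 = 0"
  using subspace_0 unfolding linear_map_on_def by (metis add_cancel_right_left)

lemma linear_map_on_lincomb:
  assumes "linear_map_on V T" "subspace V" "\<And>k. v k \<in> V"
  shows "T (lincomb v p) = lincomb (\<lambda>k. T (v k)) p"
proof -
  have T0: "T 0 = 0"
    using assms(1,2) by (rule linear_map_on_0)
  have "T (\<Sum>n\<in>A. smul (Poly_Mapping.lookup p n) (v n))
      = (\<Sum>n\<in>A. smul (Poly_Mapping.lookup p n) (T (v n)))" if "finite A" for A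
    using that
  proof induction
    case (insert n A)
    have "(\<Sum>n\<in>A. smul (Poly_Mapping.lookup p n) (v n)) \<in> V"
      "smul (Poly_Mapping.lookup p n) (v n) \<in> V"
      by (intro subspace_sum subspace_scale assms)+
    then show ?case
      using insert assms(1,3) unfolding linear_map_on_def by simp
  qed (simp add: T0)
  then show ?thesis
    by (simp add: vector_of_def)
qed

text \<open>
  Continuity at \<open>0\<close> gives a bound on a small ball, which scales to all of \<open>V\<close>.
\<close>

lemma linear_map_on_bounded:
  assumes T: "linear_map_on V T" "continuous_on V T" and V: "subspace V"
  obtains C where "C > 0" "\<And>x. x \<in> V \<Longrightarrow> norm (T x) \<le> C * norm x"
proof -
  have V0: "0 \<in> V" and T0: "T 0 = 0"
    using T(1) V by (simp_all add: subspace_0 linear_map_on_0)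
  obtain d where d: "d > 0" "\<And>x. x \<in> V \<Longrightarrow> norm x < d \<Longrightarrow> norm (T x) < 1"
    using T(2) V0 unfolding continuous_on_iff
    by (metis T0 dist_0_norm dist_commute zero_less_one)
  show ?thesis
  proof
    show "2 / d > 0" using d by simp
    fix x assume x: "x \<in> V"
    show "norm (T x) \<le> 2 / d * norm x"
    proof (cases "x = 0")
      case False
      define r where "r = d / (2 * norm x)"
      have r: "r > 0" "r * norm x = d / 2"
        using False d(1) by (auto simp: r_def)
      have "norm (T (smul (of_real r) x)) < 1"
        using r d(1) x V by (intro d subspace_scale) (auto simp: norm_smul)
      then have "r * norm (T x) < 1"
        using T(1) x r(1) unfolding linear_map_on_def by (simp add: norm_smul)
      then show ?thesis
        using False d(1) by (simp add: r_def field_simps)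
    qed (simp add: T0)
  qed
qed

lemma linear_map_on_inverse:
  assumes TS: "homeomorphism V W T S" "linear_map_on V T" and "subspace V"
  shows "linear_map_on W S"
proof -
  have V: "S x \<in> V" "T (S x) = x" if "x \<in> W" for x
    using TS(1) that unfolding homeomorphism_def by auto
  have ST: "S (T x) = x" if "x \<in> V" for x
    using TS(1) that unfolding homeomorphism_def by auto
  show ?thesis
    unfolding linear_map_on_def
  proof (intro conjI ballI allI)
    fix x y assume xy: "x \<in> W" "y \<in> W"
    have "T (S x + S y) = x + y"
      using TS(2) V xy unfolding linear_map_on_def by metis
    then show "S (x + y) = S x + S y"
      using ST V xy subspace_add[OF assms(3)] by metis
  next
    fix c x assume x: "x \<in> W"
    have "T (smul c (S x)) = smul c x"
      using TS(2) V x unfolding linear_map_on_def by metis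
    then show "S (smul c x) = smul c (S x)"
      using ST V x subspace_scale[OF assms(3)] by metis
  qed
qed

lemma isomorphic_subspaces_sym:
  "isomorphic_subspaces smul V W \<Longrightarrow> subspace V \<Longrightarrow> isomorphic_subspaces smul W V"
  unfolding isomorphic_subspaces_iff using homeomorphism_symD linear_map_on_inverse by blast

lemma isomorphic_subspaces_trans:
  assumes "isomorphic_subspaces smul U V" "isomorphic_subspaces smul V W"
  shows "isomorphic_subspaces smul U W"
proof -
  obtain T S T' S' where TS: "homeomorphism U V T S" "linear_map_on U T"
      "homeomorphism V W T' S'" "linear_map_on V T'"
    using assms unfolding isomorphic_subspaces_iff by blast
  have "T x \<in> V" if "x \<in> U" for x
    using TS(1) that unfolding homeomorphism_def by auto
  then have "linear_map_on U (T' \<circ> T)"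
    using TS(2,4) unfolding linear_map_on_def by simp
  then show ?thesis
    unfolding isomorphic_subspaces_iff using homeomorphism_compose[OF TS(1,3)] by blast
qed

lemma linear_map_on_image_subspace:
  assumes "linear_map_on V T" "subspace V"
  shows "subspace (T ` V)"
proof (rule subspaceI)
  have "T 0 = 0"
    using assms by (rule linear_map_on_0)
  then show "0 \<in> T ` V"
    using subspace_0[OF assms(2)] by (metis imageI)
next
  fix x y assume "x \<in> T ` V" "y \<in> T ` V"
  then obtain a b where "a \<in> V" "b \<in> V" "x = T a" "y = T b"
    by blast
  then have "a + b \<in> V" "x + y = T (a + b)"
    using assms subspace_add unfolding linear_map_on_def by auto
  then show "x + y \<in> T ` V" by blast
next
  fix c x assume "x \<in> T ` V"
  then obtain a where "a \<in> V" "x = T a"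
    by blast
  then have "smul c a \<in> V" "smul c x = T (smul c a)"
    using assms subspace_scale unfolding linear_map_on_def by auto
  then show "smul c x \<in> T ` V" by blast
qed

text \<open>
  A closed copy of \<open>V\<close> in \<open>W\<close> is carried to \<open>W'\<close> by the isomorphism; it stays closed because this map is a
  homeomorphism onto the closed set \<open>W'\<close>.
\<close>

lemma embeds_cong:
  assumes "isomorphic_subspaces smul V V'" "isomorphic_subspaces smul W W'"
    and "subspace V" "closed W'" "embeds smul V W"
  shows "embeds smul V' W'"
proof -
  obtain U where U: "U \<subseteq> W" "closed U" "subspace U" "isomorphic_subspaces smul V U"
    using assms(5) unfolding embeds_def by blast
  obtain T S where TS: "homeomorphism W W' T S" "linear_map_on W T"
    using assms(2) unfolding isomorphic_subspaces_iff by blast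
  have lin: "linear_map_on U T"
    using TS(2) U(1) by (rule linear_map_on_subset)
  have "closedin (top_of_set W') (T ` U)"
    using homeomorphism_imp_closed_map[OF TS(1)] U(1,2) closed_subset by blast
  then have "closed (T ` U)"
    using assms(4) closedin_closed_trans by blast
  moreover have U': "isomorphic_subspaces smul U (T ` U)"
    unfolding isomorphic_subspaces_iff using homeomorphism_of_subsets[OF TS(1) U(1) _ refl] lin TS(1) U(1)
    by blast
  moreover have "isomorphic_subspaces smul V' (T ` U)"
    using isomorphic_subspaces_sym[OF assms(1,3)] U(4) U' isomorphic_subspaces_trans by metis
  moreover have "T ` U \<subseteq> W'"
    using TS(1) U(1) unfolding homeomorphism_def by blast
  ultimately show ?thesis
    unfolding embeds_def
    by (intro exI[of _ "T ` U"]) (simp add: linear_map_on_image_subspace[OF lin U(3)])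
qed

end

section \<open>Coding embeddings by countable data\<close>

lemma countable_c00:
  assumes "countable Q"
  shows "countable (c00 Q)"
proof -
  have "c00 Q \<subseteq> Poly_Mapping.nth ` lists Q"
  proof
    fix p assume p: "p \<in> c00 Q"
    obtain N where N: "Poly_Mapping.keys p \<subseteq> {..<N}"
      using finite_nat_bounded[OF finite_keys] by blast
    have "p = Poly_Mapping.nth (map (Poly_Mapping.lookup p) [0..<N])"
      by (rule poly_mapping_eqI) (use N in \<open>auto simp: nth_default_def in_keys_iff\<close>)
    moreover have "map (Poly_Mapping.lookup p) [0..<N] \<in> lists Q"
      using p by (auto simp: c00_def)
    ultimately show "p \<in> Poly_Mapping.nth ` lists Q"
      by blast
  qed
  then show ?thesis
    using assms by (meson countable_image countable_lists countable_subset)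
qed

locale dense_scalars = normed_scalars smul
  for smul :: "'k::{real_normed_field,banach} \<Rightarrow> 'a::banach \<Rightarrow> 'a" +
  fixes Q :: "'k set"
  assumes countable_Q: "countable Q"
    and Q_0_1: "0 \<in> Q" "1 \<in> Q"
    and Q_add: "a \<in> Q \<Longrightarrow> b \<in> Q \<Longrightarrow> a + b \<in> Q"
    and Q_mult: "a \<in> Q \<Longrightarrow> b \<in> Q \<Longrightarrow> a * b \<in> Q"
    and Q_minus: "a \<in> Q \<Longrightarrow> - a \<in> Q"
    and Q_dense: "closure Q = UNIV"
begin

lemma c00_add: "p \<in> c00 Q \<Longrightarrow> q \<in> c00 Q \<Longrightarrow> p + q \<in> c00 Q"
  by (simp add: c00_def lookup_add Q_add)

lemma c00_diff: "p \<in> c00 Q \<Longrightarrow> q \<in> c00 Q \<Longrightarrow> p - q \<in> c00 Q"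
  using Q_add[OF _ Q_minus] by (simp add: c00_def lookup_minus)

lemma c00_mult: "p \<in> c00 Q \<Longrightarrow> c \<in> Q \<Longrightarrow> Poly_Mapping.map ((*) c) p \<in> c00 Q"
  by (simp add: c00_def lookup_map_mult Q_mult)

lemma c00_single: "c \<in> Q \<Longrightarrow> Poly_Mapping.single n c \<in> c00 Q"
  by (simp add: c00_def lookup_single when_def Q_0_1)

lemma zero_in_c00: "0 \<in> c00 Q"
  by (simp add: c00_def Q_0_1)

lemma lincomb_unit: "\<exists>p\<in>c00 Q. v k = lincomb v p"
  by (rule bexI[of _ "Poly_Mapping.single k 1"]) (auto simp: lincomb_single c00_single Q_0_1)

lemma scalar_limit_of_Q:
  obtains q where "\<And>n. q n \<in> Q" "q \<longlonglongrightarrow> c"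
  using Q_dense closure_sequential[of c Q] by auto

text \<open>
  The closure of the combinations over \<open>Q\<close> is a subspace over all scalars, since \<open>Q\<close> is dense.
\<close>

lemma cspan_eq_closure_lincomb: "cspan v = closure (lincomb v ` c00 Q)"
proof
  let ?D = "lincomb v ` c00 Q"
  have "subspace (closure ?D)"
  proof (rule subspaceI)
    have "lincomb v 0 = 0" by (simp add: vector_of_def)
    then show "0 \<in> closure ?D"
      by (metis closure_subset imageI subsetD zero_in_c00)
  next
    fix x y assume "x \<in> closure ?D" "y \<in> closure ?D"
    then obtain a b where ab: "\<forall>n. a n \<in> ?D" "a \<longlonglongrightarrow> x" "\<forall>n. b n \<in> ?D" "b \<longlonglongrightarrow> y"
      unfolding closure_sequential by auto
    have "a n + b n \<in> ?D" for n
    proof -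
      obtain p q where "p \<in> c00 Q" "q \<in> c00 Q" "a n = lincomb v p" "b n = lincomb v q"
        using ab by blast
      then show ?thesis
        by (metis c00_add imageI lincomb_add)
    qed
    then show "x + y \<in> closure ?D"
      using ab tendsto_add[of a x sequentially b y] unfolding closure_sequential
      by (intro exI[of _ "\<lambda>n. a n + b n"]) auto
  next
    fix c x assume "x \<in> closure ?D"
    then obtain a where a: "\<forall>n. a n \<in> ?D" "a \<longlonglongrightarrow> x"
      unfolding closure_sequential by auto
    obtain q where q: "\<And>n. q n \<in> Q" "q \<longlonglongrightarrow> c"
      using scalar_limit_of_Q by blast
    have "smul (q n) (a n) \<in> ?D" for n
    proof -
      obtain p where "p \<in> c00 Q" "a n = lincomb v p"
        using a by blast
      then show ?thesis
        by (metis c00_mult imageI lincomb_map_mult q(1))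
    qed
    then show "smul c x \<in> closure ?D"
      using smul.tendsto[OF q(2) a(2)] unfolding closure_sequential
      by (intro exI[of _ "\<lambda>n. smul (q n) (a n)"]) auto
  qed
  moreover have "v k \<in> closure ?D" for k
    using lincomb_unit closure_subset by fast
  ultimately show "cspan v \<subseteq> closure ?D"
    by (intro cspan_minimal) auto
  show "closure ?D \<subseteq> cspan v"
    by (intro closure_minimal closed_cspan) (auto intro: lincomb_in_cspan in_cspan)
qed

text \<open>
  The estimate that makes \<open>v k \<mapsto> w k\<close> a well-defined bounded linear map on the span of \<open>v\<close>. It is
  required only for coefficients in \<open>Q\<close>, so that it amounts to countably many conditions.
\<close>

definition dominates :: "real \<Rightarrow> (nat \<Rightarrow> 'a) \<Rightarrow> (nat \<Rightarrow> 'a) \<Rightarrow> bool" where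
  "dominates C v w \<longleftrightarrow> (\<forall>p\<in>c00 Q. norm (lincomb w p) \<le> C * norm (lincomb v p))"

text \<open>
  On the \<open>Q\<close>-combinations the map is Lipschitz; it extends to the closure, and the extension is
  homogeneous for all scalars because \<open>Q\<close> is dense.
\<close>

lemma dominates_extension:
  assumes dom: "dominates C v w"
  obtains T where "continuous_on (cspan v) T" "linear_map_on (cspan v) T"
    "T ` cspan v \<subseteq> cspan w" "\<And>p. p \<in> c00 Q \<Longrightarrow> T (lincomb v p) = lincomb w p"
proof -
  let ?D = "lincomb v ` c00 Q"
  \<comment> \<open>The choice of \<open>p\<close> does not matter: \<open>lip\<close> forces equal vectors to have equal images.\<close>
  define f where "f x = lincomb w (SOME p. p \<in> c00 Q \<and> lincomb v p = x)" for x
  have lip: "norm (lincomb w p - lincomb w q) \<le> C * norm (lincomb v p - lincomb v q)"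
    if "p \<in> c00 Q" "q \<in> c00 Q" for p q
    using dom c00_diff[OF that] unfolding dominates_def lincomb_diff[symmetric] by blast
  have f: "f (lincomb v p) = lincomb w p" if "p \<in> c00 Q" for p
  proof -
    let ?q = "SOME q. q \<in> c00 Q \<and> lincomb v q = lincomb v p"
    have "?q \<in> c00 Q \<and> lincomb v ?q = lincomb v p"
      by (rule someI[of _ p]) (simp add: that)
    then show ?thesis
      using lip[of ?q p] that unfolding f_def by simp
  qed
  have "dist (f x) (f y) \<le> max C 0 * dist x y" if xy: "x \<in> ?D" "y \<in> ?D" for x y
  proof -
    obtain p q where pq: "p \<in> c00 Q" "x = lincomb v p" "q \<in> c00 Q" "y = lincomb v q"
      using xy by blast
    have "dist (f x) (f y) \<le> C * dist x y"
      using pq f lip by (simp add: dist_norm)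
    also have "\<dots> \<le> max C 0 * dist x y"
      by (intro mult_right_mono) auto
    finally show ?thesis .
  qed
  then have "(max C 0)-lipschitz_on ?D f"
    by (intro lipschitz_onI) auto
  then have "uniformly_continuous_on ?D f"
    by (rule lipschitz_on_uniformly_continuous)
  then obtain T where T: "uniformly_continuous_on (closure ?D) T" "\<And>x. x \<in> ?D \<Longrightarrow> f x = T x"
    by (metis uniformly_continuous_on_extension_on_closure)
  have cont: "continuous_on (cspan v) T"
    using T(1) uniformly_continuous_imp_continuous by (simp add: cspan_eq_closure_lincomb)
  have TD: "T (lincomb v p) = lincomb w p" if "p \<in> c00 Q" for p
    using T(2) f that by (metis imageI)
  have lim: "(\<lambda>n. T (a n)) \<longlonglongrightarrow> T x" if "\<And>n. a n \<in> cspan v" "a \<longlonglongrightarrow> x" for a x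
    using that closed_sequentially[OF closed_cspan, of a v x]
    by (intro continuous_on_tendsto_compose[OF cont]) auto
  have approx: "\<exists>p. (\<forall>n. p n \<in> c00 Q) \<and> (\<lambda>n. lincomb v (p n)) \<longlonglongrightarrow> x" if "x \<in> cspan v" for x
  proof -
    obtain a where a: "\<forall>n. a n \<in> ?D" "a \<longlonglongrightarrow> x"
      using \<open>x \<in> cspan v\<close> closure_sequential[of x ?D] by (auto simp: cspan_eq_closure_lincomb)
    have "\<forall>n. \<exists>p. p \<in> c00 Q \<and> a n = lincomb v p"
      using a(1) by (simp add: image_iff Bex_def)
    from choice[OF this] obtain p where p: "\<And>n. p n \<in> c00 Q" "\<And>n. a n = lincomb v (p n)"
      by blast
    show ?thesis
      by (rule exI[of _ p]) (use p a(2) in \<open>simp flip: p(2)\<close>)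
  qed
  have in_v: "lincomb v p \<in> cspan v" for p
    by (intro lincomb_in_cspan in_cspan)
  have "linear_map_on (cspan v) T"
    unfolding linear_map_on_def
  proof (intro conjI ballI allI)
    fix x y assume "x \<in> cspan v" "y \<in> cspan v"
    then obtain p q where pq: "\<And>n. p n \<in> c00 Q" "(\<lambda>n. lincomb v (p n)) \<longlonglongrightarrow> x"
        "\<And>n. q n \<in> c00 Q" "(\<lambda>n. lincomb v (q n)) \<longlonglongrightarrow> y"
      using approx by meson
    have "(\<lambda>n. T (lincomb v (p n + q n))) \<longlonglongrightarrow> T (x + y)"
      using pq by (intro lim in_v) (simp add: lincomb_add tendsto_add)
    moreover have "(\<lambda>n. T (lincomb v (p n)) + T (lincomb v (q n))) \<longlonglongrightarrow> T x + T y"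
      using pq by (intro tendsto_add lim in_v)
    moreover have "T (lincomb v (p n + q n)) = T (lincomb v (p n)) + T (lincomb v (q n))" for n
      using pq by (simp only: TD c00_add lincomb_add[of w])
    ultimately show "T (x + y) = T x + T y"
      by (simp only: LIMSEQ_unique)
  next
    fix c x assume "x \<in> cspan v"
    then obtain p where p: "\<And>n. p n \<in> c00 Q" "(\<lambda>n. lincomb v (p n)) \<longlonglongrightarrow> x"
      using approx by meson
    obtain q where q: "\<And>n. q n \<in> Q" "q \<longlonglongrightarrow> c"
      using scalar_limit_of_Q by blast
    have "(\<lambda>n. T (lincomb v (Poly_Mapping.map ((*) (q n)) (p n)))) \<longlonglongrightarrow> T (smul c x)"
      using p q by (intro lim in_v) (simp add: lincomb_map_mult smul.tendsto)
    moreover have "(\<lambda>n. smul (q n) (T (lincomb v (p n)))) \<longlonglongrightarrow> smul c (T x)"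
      using p q by (intro smul.tendsto lim in_v)
    moreover have "T (lincomb v (Poly_Mapping.map ((*) (q n)) (p n))) = smul (q n) (T (lincomb v (p n)))" for n
      using p q by (simp only: TD c00_mult lincomb_map_mult[of w])
    ultimately show "T (smul c x) = smul c (T x)"
      by (simp only: LIMSEQ_unique)
  qed
  moreover have "T ` cspan v \<subseteq> cspan w"
    unfolding cspan_eq_closure_lincomb[of v]
    using cont closed_cspan TD
    by (intro image_closure_subset) (auto simp: cspan_eq_closure_lincomb[of v] lincomb_in_own_cspan)
  ultimately show ?thesis
    using that cont TD by blast
qed

definition equivalent_seqs :: "(nat \<Rightarrow> 'a) \<Rightarrow> (nat \<Rightarrow> 'a) \<Rightarrow> bool" where
  "equivalent_seqs v w \<longleftrightarrow> (\<exists>C>0. dominates C v w \<and> dominates C w v)"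

text \<open>
  The extensions in the two directions are inverse to each other on \<open>Q\<close>-combinations, hence on the closures.
\<close>

lemma isomorphic_cspan_if_equivalent:
  assumes "equivalent_seqs v w"
  shows "isomorphic_subspaces smul (cspan v) (cspan w)"
proof -
  obtain C where "dominates C v w" "dominates C w v"
    using assms unfolding equivalent_seqs_def by blast
  then obtain T S where T: "continuous_on (cspan v) T" "linear_map_on (cspan v) T"
      "T ` cspan v \<subseteq> cspan w" "\<And>p. p \<in> c00 Q \<Longrightarrow> T (lincomb v p) = lincomb w p"
    and S: "continuous_on (cspan w) S" "S ` cspan w \<subseteq> cspan v"
      "\<And>p. p \<in> c00 Q \<Longrightarrow> S (lincomb w p) = lincomb v p"
    by (metis dominates_extension)
  have inv: "g (f x) = x"
    if "x \<in> cspan a" "continuous_on (cspan a) f" "f ` cspan a \<subseteq> cspan b" "continuous_on (cspan b) g"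
      "\<And>p. p \<in> c00 Q \<Longrightarrow> g (f (lincomb a p)) = lincomb a p" for f g a b x
  proof -
    have "continuous_on (closure (lincomb a ` c00 Q)) (\<lambda>x. g (f x))"
      using that(2-4) continuous_on_compose2[of "cspan b" g "cspan a" f]
      by (simp add: cspan_eq_closure_lincomb[of a])
    then have "continuous_on (closure (lincomb a ` c00 Q)) (\<lambda>x. g (f x) - x)"
      by (intro continuous_intros)
    then have "g (f x) - x = 0"
      using that(1,5) unfolding cspan_eq_closure_lincomb[of a]
      by (elim continuous_constant_on_closure) auto
    then show ?thesis by simp
  qed
  have "S (T x) = x" if "x \<in> cspan v" for x
    by (rule inv[of x v T w S]) (use T S that in auto)
  moreover have "T (S x) = x" if "x \<in> cspan w" for x
    by (rule inv[of x w S v T]) (use T S that in auto)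
  ultimately have "homeomorphism (cspan v) (cspan w) T S"
    using T(1,3) S(1,2) by (intro homeomorphismI) auto
  then show ?thesis
    unfolding isomorphic_subspaces_iff using T(2) by blast
qed

text \<open>
  The images of the \<open>v k\<close> under the isomorphism form the sequence \<open>w\<close>.
\<close>

lemma equivalent_image_if_isomorphic:
  assumes "isomorphic_subspaces smul (cspan v) U" "closed U"
  obtains w where "equivalent_seqs v w" "cspan w = U"
proof -
  obtain T S where TS: "homeomorphism (cspan v) U T S" and T: "linear_map_on (cspan v) T"
    using assms(1) unfolding isomorphic_subspaces_iff by blast
  have TU: "U = T ` cspan v" and cont: "continuous_on (cspan v) T" "continuous_on U S"
    and ST: "\<And>x. x \<in> cspan v \<Longrightarrow> S (T x) = x"
    using TS unfolding homeomorphism_def by auto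
  have U: "subspace U"
    unfolding TU using T subspace_cspan by (rule linear_map_on_image_subspace)
  have S: "linear_map_on U S"
    using TS T subspace_cspan by (rule linear_map_on_inverse)
  let ?w = "\<lambda>k. T (v k)"
  obtain C where C: "C > 0" "\<And>x. x \<in> cspan v \<Longrightarrow> norm (T x) \<le> C * norm x"
    using linear_map_on_bounded[OF T cont(1) subspace_cspan] by blast
  obtain D where D: "D > 0" "\<And>x. x \<in> U \<Longrightarrow> norm (S x) \<le> D * norm x"
    using linear_map_on_bounded[OF S cont(2) U] by blast
  have TL: "T (lincomb v p) = lincomb ?w p" and in_v: "lincomb v p \<in> cspan v" for p
    by (intro linear_map_on_lincomb[OF T] subspace_cspan in_cspan lincomb_in_cspan)+
  have "norm (lincomb ?w p) \<le> max C D * norm (lincomb v p)" for p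
  proof -
    have "norm (lincomb ?w p) \<le> C * norm (lincomb v p)"
      using C(2)[OF in_v, of p] TL by simp
    also have "\<dots> \<le> max C D * norm (lincomb v p)"
      by (intro mult_right_mono) auto
    finally show ?thesis .
  qed
  moreover have "norm (lincomb v p) \<le> max C D * norm (lincomb ?w p)" for p
  proof -
    have "lincomb ?w p \<in> U" "S (lincomb ?w p) = lincomb v p"
      using TU TL in_v ST by (metis imageI, metis)
    then have "norm (lincomb v p) \<le> D * norm (lincomb ?w p)"
      using D(2) by metis
    also have "\<dots> \<le> max C D * norm (lincomb ?w p)"
      by (intro mult_right_mono) auto
    finally show ?thesis .
  qed
  ultimately have "equivalent_seqs v ?w"
    unfolding equivalent_seqs_def dominates_def using C(1) by (intro exI[of _ "max C D"]) auto
  moreover have "cspan ?w = U"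
  proof
    show "cspan ?w \<subseteq> U"
      using U assms(2) by (intro cspan_minimal) (auto simp: TU in_cspan)
    show "U \<subseteq> cspan ?w"
      unfolding TU cspan_eq_closure_lincomb[of v]
      using cont(1) closed_cspan TL
      by (intro image_closure_subset)
        (auto simp: cspan_eq_closure_lincomb[of v] lincomb_in_own_cspan)
  qed
  ultimately show ?thesis
    by (rule that)
qed

lemma dominates_mono: "dominates C v w \<Longrightarrow> C \<le> C' \<Longrightarrow> dominates C' v w"
  unfolding dominates_def by (meson mult_right_mono norm_ge_zero order_trans)

text \<open>
  If \<open>K k\<close> bounds the \<open>k\<close>-th coefficient functional, errors \<open>\<delta> k = \<eta> / (2 ^ (k+1) * K k)\<close> in the single
  vectors add up to at most \<open>\<eta>\<close> times the norm, since the factors \<open>1 / 2 ^ (k+1)\<close> sum to \<open>1\<close>.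
\<close>

lemma small_perturbation:
  assumes "\<And>k. \<exists>K. \<forall>p. norm (Poly_Mapping.lookup p k) \<le> K * norm (lincomb v p)" "\<eta> > 0"
  obtains \<delta> where "\<And>k. \<delta> k > (0::real)"
    "\<And>w w' p. (\<And>k. norm (w k - w' k) \<le> \<delta> k) \<Longrightarrow>
       norm (lincomb w p - lincomb w' p) \<le> \<eta> * norm (lincomb v p)"
proof -
  obtain K where K: "\<And>k p. norm (Poly_Mapping.lookup p k) \<le> K k * norm (lincomb v p)"
    using assms(1) by metis
  \<comment> \<open>The bound is made positive so that one can divide by it.\<close>
  define L where "L k = max (K k) 1" for k
  have L: "norm (Poly_Mapping.lookup p k) \<le> L k * norm (lincomb v p)" "L k > 0" for k p
  proof -
    have "K k * norm (lincomb v p) \<le> L k * norm (lincomb v p)"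
      unfolding L_def by (intro mult_right_mono) auto
    then show "norm (Poly_Mapping.lookup p k) \<le> L k * norm (lincomb v p)"
      using K order_trans by blast
  qed (simp add: L_def)
  define \<delta> where "\<delta> k = \<eta> * (1/2)^Suc k / L k" for k
  show ?thesis
  proof
    show "\<delta> k > 0" for k
      using L(2) assms(2) by (simp add: \<delta>_def)
    fix w w' :: "nat \<Rightarrow> 'a" and p assume close: "\<And>k. norm (w k - w' k) \<le> \<delta> k"
    let ?N = "norm (lincomb v p)"
    have summand: "norm (Poly_Mapping.lookup p k) * norm (w k - w' k) \<le> \<eta> * ?N * (1/2)^Suc k" for k
    proof -
      have "norm (Poly_Mapping.lookup p k) * norm (w k - w' k) \<le> (L k * ?N) * \<delta> k"
        using L close by (intro mult_mono) (auto simp: less_imp_le)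
      also have "\<dots> = \<eta> * ?N * (1/2)^Suc k"
        using L(2)[of k] by (simp add: \<delta>_def)
      finally show ?thesis .
    qed
    have "norm (lincomb w p - lincomb w' p)
        = norm (\<Sum>k\<in>Poly_Mapping.keys p. smul (Poly_Mapping.lookup p k) (w k - w' k))"
      unfolding lincomb_diff_seq[symmetric] by (simp only: vector_of_def)
    also have "\<dots> \<le> (\<Sum>k\<in>Poly_Mapping.keys p. \<eta> * ?N * (1/2)^Suc k)"
      by (rule sum_norm_le) (simp only: norm_smul summand)
    also have "\<dots> = \<eta> * ?N * (\<Sum>k\<in>Poly_Mapping.keys p. (1/2)^Suc k)"
      by (simp only: sum_distrib_left)
    also have "\<dots> \<le> \<eta> * ?N * 1"
    proof (intro mult_left_mono)
      show "(\<Sum>k\<in>Poly_Mapping.keys p. (1/2)^Suc k) \<le> (1::real)"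
        using sum_le_suminf[OF sums_summable[OF power_half_series], of "Poly_Mapping.keys p"]
          sums_unique[OF power_half_series] by simp
    qed (use assms(2) in simp)
    finally show "norm (lincomb w p - lincomb w' p) \<le> \<eta> * norm (lincomb v p)"
      by simp
  qed
qed

text \<open>
  For \<open>r \<in> R\<close> the vector \<open>x - r\<close> has the same distance to \<open>R\<close> as \<open>x\<close>, so this distance is at most half of
  \<open>dist x r\<close>. Taking the infimum over \<open>r\<close>, the distance is at most half of itself. This replaces
  the Neumann series that shows that a small perturbation of a surjection is surjective.
\<close>

lemma subset_if_half_distance:
  assumes R: "subspace R" "closed R" and V: "subspace V" "R \<subseteq> V"
    and half: "\<And>x. x \<in> V \<Longrightarrow> infdist x R \<le> norm x / 2"
  shows "V \<subseteq> R"
proof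
  fix x assume x: "x \<in> V"
  have R_ne: "R \<noteq> {}"
    using subspace_0[OF R(1)] by blast
  have "2 * infdist x R \<le> dist x r" if r: "r \<in> R" for r
  proof -
    have "infdist x R \<le> infdist (x - r) R"
      unfolding infdist_notempty[OF R_ne, of "x - r"]
    proof (rule cINF_greatest[OF R_ne])
      fix s assume "s \<in> R"
      then have "infdist x R \<le> dist x (r + s)"
        using r by (intro infdist_le subspace_add R)
      then show "infdist x R \<le> dist (x - r) s"
        by (simp add: dist_norm algebra_simps)
    qed
    moreover have "infdist (x - r) R \<le> norm (x - r) / 2"
      using x r V by (intro half subspace_diff) auto
    ultimately show ?thesis
      by (simp add: dist_norm)
  qed
  then have "2 * infdist x R \<le> infdist x R"
    unfolding infdist_notempty[OF R_ne, of x] by (rule cINF_greatest[OF R_ne])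
  then have "infdist x R = 0"
    using infdist_nonneg[of x R] by simp
  then show "x \<in> R"
    using R(2) R_ne in_closed_iff_infdist_zero by blast
qed

text \<open>
  The combinations differ by finitely many terms, each controlled by a bounded coefficient.
\<close>

lemma dominates_finite_change:
  assumes bc: "\<And>k. \<exists>K. \<forall>p. norm (Poly_Mapping.lookup p k) \<le> K * norm (lincomb v p)"
    and "\<And>k. k \<ge> n \<Longrightarrow> v k = w k"
  obtains C where "C > 0" "dominates C v w"
proof -
  obtain K where K: "\<And>k p. norm (Poly_Mapping.lookup p k) \<le> K k * norm (lincomb v p)"
    using bc by metis
  define C where "C = 1 + (\<Sum>k<n. \<bar>K k\<bar> * norm (w k - v k))"
  have "norm (lincomb w p) \<le> C * norm (lincomb v p)" for p
  proof -
    let ?A = "Poly_Mapping.keys p \<union> {..<n}"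
    have "lincomb (\<lambda>k. w k - v k) p = (\<Sum>k\<in>?A. smul (Poly_Mapping.lookup p k) (w k - v k))"
      by (intro lincomb_superset) auto
    also have "\<dots> = (\<Sum>k<n. smul (Poly_Mapping.lookup p k) (w k - v k))"
      by (rule sum.mono_neutral_right) (use assms(2) in auto)
    finally have "norm (lincomb w p - lincomb v p) = norm (\<Sum>k<n. smul (Poly_Mapping.lookup p k) (w k - v k))"
      by (simp add: lincomb_diff_seq)
    also have "\<dots> \<le> (\<Sum>k<n. \<bar>K k\<bar> * norm (w k - v k) * norm (lincomb v p))"
    proof (rule sum_norm_le)
      fix k
      have "norm (Poly_Mapping.lookup p k) \<le> \<bar>K k\<bar> * norm (lincomb v p)"
        using K[of p k] mult_right_mono[OF abs_ge_self[of "K k"] norm_ge_zero[of "lincomb v p"]]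
        by linarith
      then have "norm (Poly_Mapping.lookup p k) * norm (w k - v k)
          \<le> (\<bar>K k\<bar> * norm (lincomb v p)) * norm (w k - v k)"
        by (rule mult_right_mono) simp
      then show "norm (smul (Poly_Mapping.lookup p k) (w k - v k))
          \<le> \<bar>K k\<bar> * norm (w k - v k) * norm (lincomb v p)"
        by (simp add: norm_smul mult_ac)
    qed
    finally have "norm (lincomb w p - lincomb v p) \<le> (C - 1) * norm (lincomb v p)"
      by (simp add: C_def sum_distrib_right)
    then show ?thesis
      using norm_triangle_sub[of "lincomb w p" "lincomb v p"] by (simp add: left_diff_distrib)
  qed
  moreover have "C > 0"
    unfolding C_def by (intro add_pos_nonneg sum_nonneg) auto
  ultimately show ?thesis
    using that unfolding dominates_def by blast
qed

lemma isomorphic_cspan_finite_change: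
  assumes "\<And>k. \<exists>K. \<forall>p. norm (Poly_Mapping.lookup p k) \<le> K * norm (lincomb v p)"
    and "\<And>k. \<exists>K. \<forall>p. norm (Poly_Mapping.lookup p k) \<le> K * norm (lincomb w p)"
    and "\<And>k. k \<ge> n \<Longrightarrow> v k = w k"
  shows "isomorphic_subspaces smul (cspan v) (cspan w)"
proof (rule isomorphic_cspan_if_equivalent)
  obtain C where C: "C > 0" "dominates C v w"
    using dominates_finite_change[OF assms(1,3)] by blast
  obtain D where D: "D > 0" "dominates D w v"
    using dominates_finite_change[OF assms(2) assms(3)[symmetric]] by blast
  have "dominates (max C D) v w" "dominates (max C D) w v"
    using C D by (auto elim: dominates_mono)
  then show "equivalent_seqs v w"
    unfolding equivalent_seqs_def using C(1) by (intro exI[of _ "max C D"]) auto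
qed

text \<open>
  The combinations \<open>p k\<close> of the vectors \<open>u\<close> span an isomorphic copy of the span of \<open>v\<close>. The constant is a
  natural number, because it is part of a code from a countable set.
\<close>

definition coded_by :: "(nat \<Rightarrow> 'a) \<Rightarrow> (nat \<Rightarrow> 'a) \<Rightarrow> nat \<Rightarrow> (nat \<Rightarrow> (nat \<Rightarrow>\<^sub>0 'k)) \<Rightarrow> bool" where
  "coded_by v u C p \<longleftrightarrow>
     dominates (real C) v (\<lambda>k. lincomb u (p k)) \<and> dominates (real C) (\<lambda>k. lincomb u (p k)) v"

lemma equivalent_if_coded: "coded_by v u C p \<Longrightarrow> equivalent_seqs v (\<lambda>k. lincomb u (p k))"
  unfolding coded_by_def equivalent_seqs_def
  by (intro exI[of _ "real C + 1"]) (auto elim: dominates_mono)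

text \<open>
  The perturbation is chosen with \<open>\<eta> = 1 / (2 C)\<close>: then half of the lower estimate survives, and a vector
  of the span of \<open>w\<close> is moved by at most half of its norm, so a sequence spanning all of \<open>cspan u\<close> still
  does so after the perturbation.
\<close>

lemma coded_if_equivalent:
  assumes bc: "\<And>k. \<exists>K. \<forall>p. norm (Poly_Mapping.lookup p k) \<le> K * norm (lincomb v p)"
    and "equivalent_seqs v w" "\<And>k. w k \<in> cspan u"
  obtains C p where "\<And>k. p k \<in> c00 Q" "coded_by v u C p"
    "cspan w = cspan u \<Longrightarrow> cspan u \<subseteq> cspan (\<lambda>k. lincomb u (p k))"
proof -
  obtain C where C: "C > 0" "dominates C v w" "dominates C w v"
    using assms(2) unfolding equivalent_seqs_def by blast
  have "1 / (2 * C) > 0" using C(1) by simp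
  with bc obtain \<delta> where \<delta>: "\<And>k. \<delta> k > (0::real)"
    "\<And>w w' p. (\<And>k. norm (w k - w' k) \<le> \<delta> k) \<Longrightarrow>
       norm (lincomb w p - lincomb w' p) \<le> 1 / (2 * C) * norm (lincomb v p)"
    by (rule small_perturbation) blast
  have "\<exists>p\<in>c00 Q. dist (lincomb u p) (w k) < \<delta> k" for k
    using assms(3)[of k] \<delta>(1)[of k] unfolding cspan_eq_closure_lincomb closure_approachable by blast
  then obtain p where p: "\<And>k. p k \<in> c00 Q" "\<And>k. dist (lincomb u (p k)) (w k) < \<delta> k"
    by metis
  define w' where "w' = (\<lambda>k. lincomb u (p k))"
  have close: "norm (lincomb w a - lincomb w' a) \<le> 1 / (2 * C) * norm (lincomb v a)" for a
    using p(2) by (intro \<delta>(2)) (simp add: w'_def dist_norm norm_minus_commute less_imp_le)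
  have "dominates (C + 1 / (2 * C)) v w'"
    unfolding dominates_def
  proof
    fix a assume "a \<in> c00 Q"
    then have "norm (lincomb w a) \<le> C * norm (lincomb v a)"
      using C(2) unfolding dominates_def by blast
    then show "norm (lincomb w' a) \<le> (C + 1 / (2 * C)) * norm (lincomb v a)"
      using close[of a] norm_triangle_sub[of "lincomb w' a" "lincomb w a"]
      by (simp add: norm_minus_commute distrib_right)
  qed
  moreover have "dominates (2 * C) w' v"
    unfolding dominates_def
  proof
    fix a assume "a \<in> c00 Q"
    then have "norm (lincomb v a) \<le> C * norm (lincomb w a)"
      using C(3) unfolding dominates_def by blast
    also have "\<dots> \<le> C * (norm (lincomb w' a) + 1 / (2 * C) * norm (lincomb v a))"
      using close[of a] norm_triangle_sub[of "lincomb w a" "lincomb w' a"] C(1)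
      by (intro mult_left_mono) auto
    also have "\<dots> = C * norm (lincomb w' a) + norm (lincomb v a) / 2"
      using C(1) by (simp add: field_simps)
    finally show "norm (lincomb v a) \<le> 2 * C * norm (lincomb w' a)"
      by simp
  qed
  moreover obtain M :: nat where "max (C + 1 / (2 * C)) (2 * C) \<le> real M"
    using real_arch_simple by blast
  ultimately have "coded_by v u M p"
    unfolding coded_by_def w'_def[symmetric] by (auto elim!: dominates_mono)
  moreover have "cspan u \<subseteq> cspan w'" if eq: "cspan w = cspan u"
  proof (rule subset_if_half_distance)
    show "cspan w' \<subseteq> cspan u"
      unfolding w'_def by (intro cspan_minimal subspace_cspan closed_cspan lincomb_in_cspan in_cspan)
    have "infdist x (cspan w') \<le> norm x / 2" if x: "x \<in> lincomb w ` c00 Q" for x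
    proof -
      obtain a where a: "a \<in> c00 Q" "x = lincomb w a"
        using x by blast
      have "infdist x (cspan w') \<le> dist x (lincomb w' a)"
        by (intro infdist_le lincomb_in_cspan in_cspan)
      also have "\<dots> \<le> 1 / (2 * C) * norm (lincomb v a)"
        using close[of a] a(2) by (simp add: dist_norm)
      also have "\<dots> \<le> 1 / (2 * C) * (C * norm x)"
        using a C(1,3) unfolding dominates_def by (intro mult_left_mono) auto
      also have "\<dots> = norm x / 2"
        using C(1) by simp
      finally show ?thesis .
    qed
    moreover have "closed {x. infdist x (cspan w') \<le> norm x / 2}"
      by (intro closed_Collect_le continuous_intros) auto
    ultimately have "closure (lincomb w ` c00 Q) \<subseteq> {x. infdist x (cspan w') \<le> norm x / 2}"
      by (intro closure_minimal) auto
    then show "infdist x (cspan w') \<le> norm x / 2" if "x \<in> cspan u" for x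
      using that eq cspan_eq_closure_lincomb[of w] by auto
  qed (auto intro: subspace_cspan closed_cspan)
  ultimately show ?thesis
    using that p(1) unfolding w'_def by blast
qed

theorem embeds_iff_coded:
  assumes bc: "\<And>k. \<exists>K. \<forall>p. norm (Poly_Mapping.lookup p k) \<le> K * norm (lincomb v p)"
  shows "embeds smul (cspan v) (cspan u) \<longleftrightarrow> (\<exists>C p. (\<forall>k. p k \<in> c00 Q) \<and> coded_by v u C p)"
proof
  assume "embeds smul (cspan v) (cspan u)"
  then obtain U where U: "U \<subseteq> cspan u" "closed U" "isomorphic_subspaces smul (cspan v) U"
    unfolding embeds_def by blast
  then obtain w where w: "equivalent_seqs v w" "cspan w = U"
    using equivalent_image_if_isomorphic by blast
  then have "w k \<in> cspan u" for k
    using U(1) in_cspan by blast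
  then show "\<exists>C p. (\<forall>k. p k \<in> c00 Q) \<and> coded_by v u C p"
    using coded_if_equivalent[OF bc w(1)] by metis
next
  assume "\<exists>C p. (\<forall>k. p k \<in> c00 Q) \<and> coded_by v u C p"
  then obtain C p where "coded_by v u C p"
    by blast
  then have "isomorphic_subspaces smul (cspan v) (cspan (\<lambda>k. lincomb u (p k)))"
    by (intro isomorphic_cspan_if_equivalent equivalent_if_coded)
  moreover have "cspan (\<lambda>k. lincomb u (p k)) \<subseteq> cspan u"
    by (intro cspan_minimal subspace_cspan closed_cspan lincomb_in_cspan in_cspan)
  ultimately show "embeds smul (cspan v) (cspan u)"
    unfolding embeds_def using subspace_cspan closed_cspan by blast
qed

text \<open>
  In addition to the embedding, a code records for all \<open>j\<close> and \<open>m\<close> a combination of the image vectors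
  within \<open>1 / (m+1)\<close> of \<open>u j\<close>; this says that the image is everything.
\<close>

theorem isomorphic_iff_coded:
  assumes bc: "\<And>k. \<exists>K. \<forall>p. norm (Poly_Mapping.lookup p k) \<le> K * norm (lincomb v p)"
  shows "isomorphic_subspaces smul (cspan v) (cspan u) \<longleftrightarrow>
    (\<exists>C p q. (\<forall>k. p k \<in> c00 Q) \<and> (\<forall>k. q k \<in> c00 Q) \<and> coded_by v u C p \<and>
      (\<forall>j m. dist (lincomb (\<lambda>k. lincomb u (p k)) (q (prod_encode (j, m)))) (u j) \<le> 1 / real (Suc m)))"
proof
  assume "isomorphic_subspaces smul (cspan v) (cspan u)"
  then obtain w where w: "equivalent_seqs v w" "cspan w = cspan u"
    using equivalent_image_if_isomorphic[OF _ closed_cspan] by metis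
  have "w k \<in> cspan u" for k
    using w(2) in_cspan by blast
  then obtain C p where p: "\<And>k. p k \<in> c00 Q" "coded_by v u C p"
      "cspan u \<subseteq> cspan (\<lambda>k. lincomb u (p k))"
    using coded_if_equivalent[OF bc w(1)] w(2) by metis
  let ?w = "\<lambda>k. lincomb u (p k)"
  have "\<exists>q\<in>c00 Q. dist (lincomb ?w q) (u j) < 1 / real (Suc m)" for j m
  proof -
    have "u j \<in> closure (lincomb ?w ` c00 Q)"
      using p(3) in_cspan cspan_eq_closure_lincomb[of ?w] by blast
    then show ?thesis
      unfolding closure_approachable by (metis (no_types, lifting) imageE of_nat_0_less_iff
          zero_less_Suc zero_less_divide_1_iff)
  qed
  then obtain r where r: "\<And>j m. r j m \<in> c00 Q"
      "\<And>j m. dist (lincomb ?w (r j m)) (u j) < 1 / real (Suc m)"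
    by metis
  define q where "q n = (case prod_decode n of (j, m) \<Rightarrow> r j m)" for n
  have "\<forall>k. q k \<in> c00 Q"
    "\<forall>j m. dist (lincomb ?w (q (prod_encode (j, m)))) (u j) \<le> 1 / real (Suc m)"
    using r by (auto simp: q_def less_imp_le split: prod.split)
  with p show "\<exists>C p q. (\<forall>k. p k \<in> c00 Q) \<and> (\<forall>k. q k \<in> c00 Q) \<and> coded_by v u C p \<and>
      (\<forall>j m. dist (lincomb (\<lambda>k. lincomb u (p k)) (q (prod_encode (j, m)))) (u j) \<le> 1 / real (Suc m))"
    by blast
next
  assume "\<exists>C p q. (\<forall>k. p k \<in> c00 Q) \<and> (\<forall>k. q k \<in> c00 Q) \<and> coded_by v u C p \<and>
      (\<forall>j m. dist (lincomb (\<lambda>k. lincomb u (p k)) (q (prod_encode (j, m)))) (u j) \<le> 1 / real (Suc m))"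
  then obtain C p q where q: "coded_by v u C p"
      "\<And>j m. dist (lincomb (\<lambda>k. lincomb u (p k)) (q (prod_encode (j, m)))) (u j) \<le> 1 / real (Suc m)"
    by blast
  let ?w = "\<lambda>k. lincomb u (p k)"
  have "u j \<in> closure (cspan ?w)" for j
    unfolding closure_approachable
  proof (intro allI impI)
    fix \<epsilon> :: real assume "\<epsilon> > 0"
    then obtain m where "1 / real (Suc m) < \<epsilon>"
      using nat_approx_posE by blast
    moreover have "lincomb ?w (q (prod_encode (j, m))) \<in> cspan ?w"
      by (intro lincomb_in_cspan in_cspan)
    ultimately show "\<exists>y\<in>cspan ?w. dist y (u j) < \<epsilon>"
      using q(2)[of j m] by (meson le_less_trans)
  qed
  then have "cspan u \<subseteq> cspan ?w"
    by (intro cspan_minimal subspace_cspan closed_cspan) (simp add: closed_cspan)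
  moreover have "cspan ?w \<subseteq> cspan u"
    by (intro cspan_minimal subspace_cspan closed_cspan lincomb_in_cspan in_cspan)
  ultimately show "isomorphic_subspaces smul (cspan v) (cspan u)"
    using isomorphic_cspan_if_equivalent[OF equivalent_if_coded[OF q(1)]] by simp
qed

end

section \<open>Continuity of the coordinate functionals\<close>

locale schauder_space = normed_scalars smul
  for smul :: "'k::{real_normed_field,banach} \<Rightarrow> 'a::banach \<Rightarrow> 'a" +
  fixes e :: "nat \<Rightarrow> 'a"
  assumes basis: "schauder_basis smul e"
begin

definition coef :: "'a \<Rightarrow> nat \<Rightarrow> 'k" where
  "coef x = (THE a. (\<lambda>n. smul (a n) (e n)) sums x)"

definition psum :: "nat \<Rightarrow> 'a \<Rightarrow> 'a" where
  "psum n x = (\<Sum>i<n. smul (coef x i) (e i))"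

lemma coef_sums: "(\<lambda>n. smul (coef x n) (e n)) sums x"
proof -
  have "\<exists>!a. (\<lambda>n. smul (a n) (e n)) sums x"
    using basis by (simp add: schauder_basis_def)
  then show ?thesis
    unfolding coef_def by (rule theI')
qed

lemma coef_unique: "(\<lambda>n. smul (a n) (e n)) sums x \<Longrightarrow> coef x = a"
  using basis coef_sums unfolding schauder_basis_def by metis

lemma psum_tendsto: "(\<lambda>n. psum n x) \<longlonglongrightarrow> x"
  using coef_sums unfolding psum_def sums_def .

lemma coef_add: "coef (x + y) n = coef x n + coef y n"
proof -
  have "coef (x + y) = (\<lambda>n. coef x n + coef y n)"
    by (rule coef_unique) (simp add: scale_left_distrib sums_add coef_sums)
  then show ?thesis by simp
qed

lemma coef_smul: "coef (smul c x) n = c * coef x n"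
proof -
  have "coef (smul c x) = (\<lambda>n. c * coef x n)"
    by (rule coef_unique)
      (simp only: scale_scale[symmetric] bounded_linear.sums[OF smul.bounded_linear_right coef_sums])
  then show ?thesis by simp
qed

lemma coef_lincomb: "coef (lincomb e p) n = Poly_Mapping.lookup p n"
proof -
  have "(\<lambda>n. smul (Poly_Mapping.lookup p n) (e n)) sums lincomb e p"
    unfolding vector_of_def by (rule sums_finite) (auto simp: in_keys_iff)
  then show ?thesis
    by (simp add: coef_unique)
qed

lemma basis_nonzero: "e n \<noteq> 0"
proof
  assume "e n = 0"
  then have "lincomb e (Poly_Mapping.single n 1) = lincomb e 0"
    by (simp add: lincomb_single vector_of_def)
  then show False
    by (metis coef_lincomb lookup_single_eq lookup_zero zero_neq_one)
qed

lemma psum_add: "psum n (x + y) = psum n x + psum n y"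
  by (simp add: psum_def coef_add scale_left_distrib sum.distrib)

lemma psum_smul: "psum n (smul c x) = smul c (psum n x)"
  by (simp add: psum_def coef_smul scale_sum_right)

lemma psum_scaleR: "psum n (r *\<^sub>R x) = r *\<^sub>R psum n x"
  using psum_smul[of n "of_real r" x] by (simp add: smul_of_real)

lemma psum_diff: "psum n (x - y) = psum n x - psum n y"
  using psum_add[of n "x - y" y] by simp

lemma norm_coef_le:
  assumes "\<And>n. norm (psum n x) \<le> B"
  shows "norm (coef x n) \<le> 2 * B / norm (e n)"
proof -
  have "smul (coef x n) (e n) = psum (Suc n) x - psum n x"
    by (simp add: psum_def)
  then have "norm (smul (coef x n) (e n)) \<le> B + B"
    using norm_triangle_ineq4[of "psum (Suc n) x" "psum n x"] assms[of n] assms[of "Suc n"] by simp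
  then show ?thesis
    using basis_nonzero[of n] by (simp add: norm_smul field_simps)
qed

definition bounded_psums :: "real \<Rightarrow> 'a set" where
  "bounded_psums B = {x. \<forall>n. norm (psum n x) \<le> B}"

text \<open>
  The partial sums of the expansion of \<open>x\<close> converge.
\<close>

lemma bounded_psums_absorb: "\<exists>N::nat. x \<in> bounded_psums (real N)"
proof -
  have "Bseq (\<lambda>n. psum n x)"
    using psum_tendsto by (meson convergentI convergent_imp_Bseq)
  then obtain K where K: "\<And>n. norm (psum n x) \<le> K"
    unfolding Bseq_def by blast
  obtain N :: nat where "K \<le> real N"
    using real_arch_simple by blast
  with K show ?thesis
    unfolding bounded_psums_def by (intro exI[of _ N]) (auto intro: order_trans)
qed

text \<open>
  The sets \<open>bounded_psums N\<close> cover the space, so by Baire one of them is dense in a ball around some \<open>x0\<close>.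
  Taking differences moves the ball to the origin, and scaling gives approximations to all vectors.
\<close>

lemma bounded_psums_approximation:
  obtains K where "K > 0"
    "\<And>x \<epsilon>. \<epsilon> > 0 \<Longrightarrow> \<exists>y\<in>bounded_psums (K * norm x). norm (x - y) < \<epsilon>"
proof -
  have "\<exists>N::nat. interior (closure (bounded_psums (real N))) \<noteq> {}"
  proof (rule ccontr)
    assume none: "\<nexists>N::nat. interior (closure (bounded_psums (real N))) \<noteq> {}"
    have "euclidean interior_of \<Union>(range (\<lambda>N::nat. closure (bounded_psums (real N)))) = {}"
      by (rule Baire_category_alt) (use none in \<open>auto simp: completely_metrizable_space_euclidean\<close>)
    moreover have "(\<Union>(range (\<lambda>N::nat. closure (bounded_psums (real N))))) = UNIV"
      using bounded_psums_absorb closure_subset by fast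
    ultimately show False by simp
  qed
  then obtain N :: nat and x0 where "x0 \<in> interior (closure (bounded_psums (real N)))"
    by blast
  then obtain r where r: "r > 0" "ball x0 r \<subseteq> closure (bounded_psums (real N))"
    unfolding mem_interior by blast
  have small: "\<exists>y\<in>bounded_psums (2 * real N). norm (h - y) < \<epsilon>" if h: "norm h < r" and "\<epsilon> > 0" for h \<epsilon>
  proof -
    have "x0 + h \<in> closure (bounded_psums (real N))" "x0 \<in> closure (bounded_psums (real N))"
      using r h by (auto simp: dist_norm)
    then obtain a b where ab: "a \<in> bounded_psums (real N)" "b \<in> bounded_psums (real N)"
        "dist a (x0 + h) < \<epsilon> / 2" "dist b x0 < \<epsilon> / 2"
      using \<open>\<epsilon> > 0\<close> unfolding closure_approachable by (meson half_gt_zero)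
    show ?thesis
    proof
      have "norm (psum n (a - b)) \<le> 2 * real N" for n
        using ab(1,2) norm_triangle_ineq4[of "psum n a" "psum n b"]
        unfolding bounded_psums_def psum_diff by (smt (verit) mem_Collect_eq)
      then show "a - b \<in> bounded_psums (2 * real N)"
        by (simp add: bounded_psums_def)
      have "h - (a - b) = (b - x0) - (a - (x0 + h))"
        by simp
      then show "norm (h - (a - b)) < \<epsilon>"
        using ab(3,4) norm_triangle_ineq4[of "b - x0" "a - (x0 + h)"] by (simp only: dist_norm)
    qed
  qed
  show ?thesis
  proof
    \<comment> \<open>\<open>N + 1\<close> instead of \<open>N\<close> keeps the constant positive when \<open>N = 0\<close>.\<close>
    show "4 * (real N + 1) / r > 0"
      using r by simp
    fix x and \<epsilon> :: real assume \<epsilon>: "\<epsilon> > 0"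
    show "\<exists>y\<in>bounded_psums (4 * (real N + 1) / r * norm x). norm (x - y) < \<epsilon>"
    proof (cases "x = 0")
      case True
      have "psum n 0 = 0" for n
        using psum_diff[of n x x] by simp
      then show ?thesis
        using True \<epsilon> by (intro bexI[of _ 0]) (auto simp: bounded_psums_def)
    next
      case False
      \<comment> \<open>The factor \<open>2\<close> puts \<open>x / t\<close> strictly inside the ball of radius \<open>r\<close>.\<close>
      define t where "t = 2 * norm x / r"
      have t: "t > 0" using False r by (simp add: t_def)
      have "norm ((1 / t) *\<^sub>R x) < r"
        using False r by (simp add: t_def)
      then obtain y where y: "y \<in> bounded_psums (2 * real N)"
          "norm ((1 / t) *\<^sub>R x - y) < \<epsilon> / t"
        using small \<epsilon> t by (metis divide_pos_pos)
      show ?thesis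
      proof
        have "norm (psum n (t *\<^sub>R y)) \<le> 4 * (real N + 1) / r * norm x" for n
        proof -
          have "norm (psum n (t *\<^sub>R y)) \<le> t * (2 * (real N + 1))"
            using y(1) t unfolding psum_scaleR norm_scaleR bounded_psums_def
            by (auto intro!: mult_left_mono elim!: allE[of _ n])
          then show ?thesis
            by (simp add: t_def field_simps)
        qed
        then show "t *\<^sub>R y \<in> bounded_psums (4 * (real N + 1) / r * norm x)"
          by (simp add: bounded_psums_def)
        have "x - t *\<^sub>R y = t *\<^sub>R ((1 / t) *\<^sub>R x - y)"
          using t by (simp add: scaleR_diff_right)
        then show "norm (x - t *\<^sub>R y) < \<epsilon>"
          using y(2) t by (simp add: pos_less_divide_eq mult.commute)
      qed
    qed
  qed
qed

text \<open>
  Adding the expansions of the \<open>y i\<close> coordinatewise gives coefficients \<open>a\<close>. Their \<open>n\<close>-th partial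
  sum is the sum over \<open>i\<close> of \<open>psum n (y i)\<close>, a series dominated by a geometric one uniformly in \<open>n\<close>. So limit
  and sum may be exchanged, and the series with coefficients \<open>a\<close> converges to \<open>x\<close>. By uniqueness it is the expansion of \<open>x\<close>.
\<close>

lemma coef_series:
  assumes bound: "\<And>n i. norm (psum n (y i)) \<le> M * (1/2)^i" and sums: "y sums x"
  shows "norm (psum n x) \<le> 2 * M"
proof -
  have M: "M \<ge> 0"
    using bound[of 0 0] by (simp add: psum_def)
  have geo: "(\<lambda>i. M * (1/2)^i) sums (2 * M)"
    using geometric_sums[of "1/2 :: real", THEN sums_mult, of M] by (simp add: mult.commute)
  have sum_coef: "summable (\<lambda>i. coef (y i) m)" for m
  proof (rule summable_comparison_test')
    show "summable (\<lambda>i. 2 / norm (e m) * (M * (1/2)^i))"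
      by (intro summable_mult sums_summable[OF geo])
    show "norm (coef (y i) m) \<le> 2 / norm (e m) * (M * (1/2)^i)" for i
      using norm_coef_le[OF bound, of i m] by simp
  qed
  define a where "a m = suminf (\<lambda>i. coef (y i) m)" for m
  have psum_sums: "(\<lambda>i. psum n (y i)) sums (\<Sum>m<n. smul (a m) (e m))" for n
    unfolding psum_def a_def
    by (intro sums_sum bounded_linear.sums[OF smul.bounded_linear_left] summable_sums sum_coef)
  have "(\<lambda>n. \<Sum>m<n. smul (a m) (e m)) \<longlonglongrightarrow> x"
  proof (rule LIMSEQ_I)
    fix \<epsilon> :: real assume \<epsilon>: "\<epsilon> > 0"
    have "(\<lambda>I. (\<Sum>i<I. y i) - x) \<longlonglongrightarrow> 0"
      using sums by (simp add: sums_def LIM_zero)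
    then have "\<forall>\<^sub>F I in sequentially. norm ((\<Sum>i<I. y i) - x) < \<epsilon> / 3"
      using \<epsilon> by (auto simp: tendsto_iff elim!: allE[of _ "\<epsilon> / 3"])
    moreover have "(\<lambda>I. 2 * M * (1/2)^I) \<longlonglongrightarrow> 2 * M * 0"
      by (intro tendsto_mult tendsto_const LIMSEQ_power_zero) auto
    then have "\<forall>\<^sub>F I in sequentially. 2 * M * (1/2)^I < \<epsilon> / 3"
      using \<epsilon> by (intro order_tendstoD(2)) auto
    ultimately have "\<forall>\<^sub>F I in sequentially.
        norm ((\<Sum>i<I. y i) - x) < \<epsilon> / 3 \<and> 2 * M * (1/2)^I < \<epsilon> / 3"
      by (rule eventually_conj)
    then obtain I where I: "norm ((\<Sum>i<I. y i) - x) < \<epsilon> / 3" "2 * M * (1/2)^I < \<epsilon> / 3"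
      by (auto dest: eventually_happens)
    have "(\<lambda>n. (\<Sum>i<I. psum n (y i)) - (\<Sum>i<I. y i)) \<longlonglongrightarrow> 0"
      by (intro LIM_zero tendsto_sum psum_tendsto)
    then obtain n0 where n0: "\<And>n. n \<ge> n0 \<Longrightarrow> norm ((\<Sum>i<I. psum n (y i)) - (\<Sum>i<I. y i)) < \<epsilon> / 3"
      using \<epsilon> unfolding lim_sequentially by (metis dist_0_norm dist_commute divide_pos_pos zero_less_numeral)
    show "\<exists>n0. \<forall>n\<ge>n0. norm ((\<Sum>m<n. smul (a m) (e m)) - x) < \<epsilon>"
    proof (intro exI allI impI)
      fix n assume "n \<ge> n0"
      have tail: "norm (suminf (\<lambda>i. psum n (y (i + I)))) \<le> 2 * M * (1/2)^I"
      proof -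
        have geo': "(\<lambda>i. M * (1/2)^(i + I)) sums (2 * M * (1/2)^I)"
          using sums_mult2[OF geo, of "(1/2)^I"] by (simp add: power_add mult.assoc)
        then show ?thesis
          using norm_suminf_le[of "\<lambda>i. psum n (y (i + I))" "\<lambda>i. M * (1/2)^(i + I)"] bound
          by (simp add: sums_iff)
      qed
      have "(\<Sum>m<n. smul (a m) (e m)) = suminf (\<lambda>i. psum n (y (i + I))) + (\<Sum>i<I. psum n (y i))"
        using suminf_split_initial_segment[OF sums_summable[OF psum_sums]]
          sums_unique[OF psum_sums] by metis
      then have "(\<Sum>m<n. smul (a m) (e m)) - x = suminf (\<lambda>i. psum n (y (i + I))) +
          ((\<Sum>i<I. psum n (y i)) - (\<Sum>i<I. y i)) + ((\<Sum>i<I. y i) - x)"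
        by simp
      then show "norm ((\<Sum>m<n. smul (a m) (e m)) - x) < \<epsilon>"
        using tail I n0[OF \<open>n \<ge> n0\<close>]
          norm_triangle_ineq[of "suminf (\<lambda>i. psum n (y (i + I))) + ((\<Sum>i<I. psum n (y i)) - (\<Sum>i<I. y i))"
            "(\<Sum>i<I. y i) - x"]
          norm_triangle_ineq[of "suminf (\<lambda>i. psum n (y (i + I)))" "(\<Sum>i<I. psum n (y i)) - (\<Sum>i<I. y i)"]
        by simp
    qed
  qed
  then have "coef x = a"
    by (intro coef_unique) (simp add: sums_def)
  then have "psum n x = suminf (\<lambda>i. psum n (y i))"
    using sums_unique[OF psum_sums] by (simp add: psum_def)
  then show ?thesis
    using norm_suminf_le[of "\<lambda>i. psum n (y i)" "\<lambda>i. M * (1/2)^i"] bound geo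
    by (simp add: sums_iff)
qed

text \<open>
  Successive approximation, as in the open mapping theorem: \<open>x\<close> is a sum of vectors \<open>y i\<close> whose partial
  sums are bounded by \<open>K * norm x / 2 ^ i\<close>.
\<close>

theorem coef_bounded: "\<exists>K. \<forall>x. norm (coef x n) \<le> K * norm x"
proof -
  obtain K where K: "K > 0"
    and "\<And>x \<epsilon>. \<epsilon> > 0 \<Longrightarrow> \<exists>y\<in>bounded_psums (K * norm x). norm (x - y) < \<epsilon>"
    using bounded_psums_approximation by blast
  then have "\<forall>x \<epsilon>. \<exists>y. \<epsilon> > 0 \<longrightarrow> y \<in> bounded_psums (K * norm x) \<and> norm (x - y) < \<epsilon>"
    by blast
  then obtain A where A: "\<And>x \<epsilon>. \<epsilon> > 0 \<Longrightarrow> A x \<epsilon> \<in> bounded_psums (K * norm x)"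
      "\<And>x \<epsilon>. \<epsilon> > 0 \<Longrightarrow> norm (x - A x \<epsilon>) < \<epsilon>"
    by metis
  have psum_bound: "norm (psum n x) \<le> 2 * (K * norm x)" if x: "x \<noteq> 0" for n x
  proof -
    define r where "r = rec_nat x (\<lambda>i z. z - A z (norm x * (1/2)^Suc i))"
    define y where "y i = A (r i) (norm x * (1/2)^Suc i)" for i
    have r: "r 0 = x" "r (Suc i) = r i - y i" for i
      by (simp_all add: r_def y_def)
    have pos: "norm x * (1/2)^i > 0" for i
      using x by simp
    have r_le: "norm (r i) \<le> norm x * (1/2)^i" for i
    proof (cases i)
      case (Suc j)
      show ?thesis
        unfolding Suc r(2) y_def using A(2)[OF pos] less_imp_le by blast
    qed (simp add: r)
    have "(\<Sum>i<I. y i) = x - r I" for I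
      by (induction I) (simp_all add: r)
    moreover have "(\<lambda>I. x - r I) \<longlonglongrightarrow> x - 0"
    proof (intro tendsto_diff tendsto_const)
      have "(\<lambda>i. norm x * (1/2)^i) \<longlonglongrightarrow> norm x * 0"
        by (intro tendsto_mult tendsto_const LIMSEQ_power_zero) auto
      then show "r \<longlonglongrightarrow> 0"
        using Lim_null_comparison[of r "\<lambda>i. norm x * (1/2)^i" sequentially] r_le by simp
    qed
    ultimately have "y sums x"
      by (simp add: sums_def)
    moreover have "norm (psum n (y i)) \<le> K * norm x * (1/2)^i" for n i
    proof -
      have "norm (psum n (y i)) \<le> K * norm (r i)"
        using A(1)[OF pos] unfolding y_def bounded_psums_def by blast
      also have "\<dots> \<le> K * (norm x * (1/2)^i)"
        using K r_le by (intro mult_left_mono) auto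
      finally show ?thesis by simp
    qed
    ultimately show ?thesis
      by (intro coef_series)
  qed
  have "norm (coef x n) \<le> 4 * K / norm (e n) * norm x" for x
  proof (cases "x = 0")
    case True
    then show ?thesis
      using coef_smul[of 0 x n] by simp
  next
    case False
    then show ?thesis
      using norm_coef_le[OF psum_bound[OF False], of n] by simp
  qed
  then show ?thesis by blast
qed

end

section \<open>Block bases\<close>

locale block_space = schauder_space smul e + dense_scalars smul Q
  for smul :: "'k::{real_normed_field,banach} \<Rightarrow> 'a::banach \<Rightarrow> 'a" and e :: "nat \<Rightarrow> 'a" and Q :: "'k set" +
  assumes Q_inverse: "a \<in> Q \<Longrightarrow> inverse a \<in> Q"
    and Q_norm: "p \<in> c00 Q \<Longrightarrow> of_real (norm (lincomb e p)) \<in> Q"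
begin

abbreviation "blocks \<equiv> block_bases smul e Q"

abbreviation vec :: "(nat \<Rightarrow> (nat \<Rightarrow>\<^sub>0 'k)) \<Rightarrow> nat \<Rightarrow> 'a" where
  "vec z \<equiv> \<lambda>k. lincomb e (z k)"

lemma closed_span_eq: "closed_span smul e z = cspan (vec z)"
  by (simp add: closed_span_def cspan_def)

lemma Q0_keys: "p \<in> Q0 smul e Q \<Longrightarrow> Poly_Mapping.keys p \<noteq> {}"
  by (auto simp: Q0_def vector_of_def)

lemma block_bases_iff:
  "z \<in> blocks \<longleftrightarrow> (\<forall>k. z k \<in> Q0 smul e Q) \<and>
    (\<forall>k. \<forall>i\<in>Poly_Mapping.keys (z k). \<forall>j\<in>Poly_Mapping.keys (z (Suc k)). i < j)"
proof -
  have "Max (Poly_Mapping.keys p) < Min (Poly_Mapping.keys q) \<longleftrightarrow>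
      (\<forall>i\<in>Poly_Mapping.keys p. \<forall>j\<in>Poly_Mapping.keys q. i < j)"
    if "p \<in> Q0 smul e Q" "q \<in> Q0 smul e Q" for p q
    using Q0_keys[OF that(1)] Q0_keys[OF that(2)] by (simp add: Max_less_iff Min_gr_iff) blast
  then show ?thesis
    unfolding block_bases_def by blast
qed

lemma block_less:
  assumes z: "z \<in> blocks" and "k < l" "i \<in> Poly_Mapping.keys (z k)" "j \<in> Poly_Mapping.keys (z l)"
  shows "i < j"
  using assms(2,4)
proof (induction l arbitrary: j)
  case (Suc l)
  show ?case
  proof (cases "k = l")
    case True
    then show ?thesis
      using z assms(3) Suc.prems unfolding block_bases_iff by blast
  next
    case False
    obtain m where "m \<in> Poly_Mapping.keys (z l)"
      using z Q0_keys unfolding block_bases_iff by blast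
    moreover from this have "m < j"
      using z Suc.prems unfolding block_bases_iff by blast
    ultimately show ?thesis
      using Suc False by (metis less_antisym order.strict_trans)
  qed
qed simp

text \<open>
  A basis coordinate \<open>m\<close> in the support of \<open>z k\<close> vanishes on all other blocks, so the bounded functional
  \<open>coef _ m\<close>, divided by its value at the block \<open>z k\<close>, reads off the \<open>k\<close>-th coefficient.
\<close>

lemma block_coordinate_bounded:
  assumes z: "z \<in> blocks"
  shows "\<exists>K. \<forall>p. norm (Poly_Mapping.lookup p k) \<le> K * norm (lincomb (vec z) p)"
proof -
  obtain m where m: "m \<in> Poly_Mapping.keys (z k)"
    using z Q0_keys unfolding block_bases_iff by blast
  let ?c = "Poly_Mapping.lookup (z k) m"
  obtain K where K: "\<And>x. norm (coef x m) \<le> K * norm x"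
    using coef_bounded by blast
  have coef0: "coef 0 m = 0"
    using coef_smul[of 0 0 m] by simp
  have coef_sum: "coef (sum f A) m = (\<Sum>i\<in>A. coef (f i) m)" if "finite A" for f and A :: "nat set"
    using that by induction (simp_all add: coef0 coef_add)
  have other: "Poly_Mapping.lookup (z j) m = 0" if "j \<noteq> k" for j
  proof (rule ccontr)
    assume "Poly_Mapping.lookup (z j) m \<noteq> 0"
    then have "m \<in> Poly_Mapping.keys (z j)" by (simp add: in_keys_iff)
    then show False
      using block_less[OF z _ m, of j m] block_less[OF z _ _ m, of j m] that
      by (meson less_irrefl linorder_neqE_nat)
  qed
  have coef_p: "coef (lincomb (vec z) p) m = Poly_Mapping.lookup p k * ?c" for p
  proof -
    let ?A = "insert k (Poly_Mapping.keys p)"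
    have "lincomb (vec z) p = (\<Sum>j\<in>?A. smul (Poly_Mapping.lookup p j) (vec z j))"
      by (intro lincomb_superset) auto
    then have "coef (lincomb (vec z) p) m = (\<Sum>j\<in>?A. Poly_Mapping.lookup p j * Poly_Mapping.lookup (z j) m)"
      by (simp only: coef_sum finite_insert finite_keys coef_smul coef_lincomb)
    also have "\<dots> = (\<Sum>j\<in>{k}. Poly_Mapping.lookup p j * Poly_Mapping.lookup (z j) m)"
      by (rule sum.mono_neutral_right) (use other in auto)
    finally show ?thesis by simp
  qed
  have c: "?c \<noteq> 0"
    using m by (simp add: in_keys_iff)
  have "norm (Poly_Mapping.lookup p k) \<le> K / norm ?c * norm (lincomb (vec z) p)" for p
    using K[of "lincomb (vec z) p"] c unfolding coef_p norm_mult
    by (simp add: pos_le_divide_eq)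
  then show ?thesis by blast
qed

lemma closed_span_tail_invariant:
  assumes "y \<in> blocks" "z \<in> blocks" "\<And>k. k \<ge> n \<Longrightarrow> y k = z k"
  shows "isomorphic_subspaces smul (closed_span smul e y) (closed_span smul e z)"
  unfolding closed_span_eq
  using assms by (intro isomorphic_cspan_finite_change[where n = n] block_coordinate_bounded) auto

definition unit_vec :: "nat \<Rightarrow> (nat \<Rightarrow>\<^sub>0 'k)" where
  "unit_vec j = Poly_Mapping.single j (inverse (of_real (norm (e j))))"

lemma unit_vec_in_Q0: "unit_vec j \<in> Q0 smul e Q"
proof -
  have "of_real (norm (lincomb e (Poly_Mapping.single j 1))) \<in> Q"
    by (intro Q_norm c00_single Q_0_1)
  then have "inverse (of_real (norm (e j))) \<in> Q"
    by (intro Q_inverse) (simp add: lincomb_single)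
  moreover have "norm (lincomb e (unit_vec j)) = 1"
    using basis_nonzero[of j] by (simp add: unit_vec_def lincomb_single norm_smul norm_inverse)
  ultimately show ?thesis
    by (simp add: Q0_def unit_vec_def c00_single)
qed

lemma keys_unit_vec: "Poly_Mapping.keys (unit_vec j) = {j}"
  using basis_nonzero[of j] by (simp add: unit_vec_def)

text \<open>
  Sequences cut at \<open>n\<close> and continued with the same \<open>M\<close> have a common tail.
\<close>

lemma extend_by_unit_vecs:
  assumes "z \<in> blocks" "\<And>k i. k < n \<Longrightarrow> i \<in> Poly_Mapping.keys (z k) \<Longrightarrow> i < M"
  shows "(\<lambda>k. if k < n then z k else unit_vec (M + k)) \<in> blocks"
  unfolding block_bases_iff
proof (intro conjI allI ballI)
  show "(if k < n then z k else unit_vec (M + k)) \<in> Q0 smul e Q" for k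
    using assms(1) unit_vec_in_Q0 unfolding block_bases_iff by simp
  fix k i j
  assume i: "i \<in> Poly_Mapping.keys (if k < n then z k else unit_vec (M + k))"
    and j: "j \<in> Poly_Mapping.keys (if Suc k < n then z (Suc k) else unit_vec (M + Suc k))"
  consider "Suc k < n" | "k < n" "\<not> Suc k < n" | "\<not> k < n"
    by linarith
  then show "i < j"
  proof cases
    case 1
    then show ?thesis
      using i j assms(1) unfolding block_bases_iff by auto
  next
    case 2
    then show ?thesis
      using i j assms(2)[of k i] by (simp add: keys_unit_vec)
  next
    case 3
    then show ?thesis
      using i j by (simp add: keys_unit_vec)
  qed
qed

sublocale pairs: graftable_sequence_pairs "Q0 smul e Q" blocks
proof
  show "blocks \<subseteq> UNIV \<rightarrow> Q0 smul e Q"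
    by (auto simp: block_bases_iff)
  show "countable (Q0 smul e Q)"
    by (rule countable_subset[OF _ countable_c00[OF countable_Q]]) (auto simp: Q0_def)
next
  fix x y n assume xy: "x \<in> blocks" "y \<in> blocks" "x n = y n"
  have "i < j" if i: "i \<in> Poly_Mapping.keys (if k < n then x k else y k)"
    and j: "j \<in> Poly_Mapping.keys (if Suc k < n then x (Suc k) else y (Suc k))" for k i j
  proof (cases "k < n")
    case True
    then have "(if Suc k < n then x (Suc k) else y (Suc k)) = x (Suc k)"
      using xy(3) by (auto simp: not_less_eq less_Suc_eq)
    then show ?thesis
      using i j True block_less[OF xy(1) lessI] by simp
  next
    case False
    then show ?thesis
      using i j block_less[OF xy(2) lessI] by simp
  qed
  moreover have "(if k < n then x k else y k) \<in> Q0 smul e Q" for k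
    using xy(1,2) unfolding block_bases_iff by simp
  ultimately show "(\<lambda>k. if k < n then x k else y k) \<in> blocks"
    unfolding block_bases_iff[of "\<lambda>k. if k < n then x k else y k"] by blast
next
  fix x y n assume xy: "x \<in> blocks" "y \<in> blocks"
  have "finite (\<Union>k<n. Poly_Mapping.keys (x k) \<union> Poly_Mapping.keys (y k))"
    by simp
  then obtain M where M: "(\<Union>k<n. Poly_Mapping.keys (x k) \<union> Poly_Mapping.keys (y k)) \<subseteq> {..<M}"
    using finite_nat_bounded by blast
  let ?x = "\<lambda>z k. if k < n then z k else unit_vec (M + k)"
  have "?x x \<in> blocks" "?x y \<in> blocks"
    by (rule extend_by_unit_vecs; use xy M in force)+
  then show "\<exists>x'\<in>blocks. \<exists>y'\<in>blocks. (\<forall>k<n. x' k = x k \<and> y' k = y k) \<and> (\<forall>k\<ge>n. x' k = y' k)"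
    by (intro bexI[of _ "?x x"] bexI[of _ "?x y"]) auto
qed

lemma pair_topology_eq: "prod_topology (block_topology smul e Q) (block_topology smul e Q) = pairs.pair_topology"
  by (simp add: pairs.pair_topology_def block_topology_def)

lemma locally_refutable_coded_by:
  assumes "\<And>k. locally_determined (\<lambda>s. y s k)" "\<And>k. locally_determined (\<lambda>s. z s k)"
    and "locally_determined C" "\<And>k. locally_determined (\<lambda>s. p s k)"
  shows "locally_refutable (\<lambda>s. coded_by (vec (y s)) (vec (z s)) (C s) (p s))"
proof -
  have v: "locally_determined (\<lambda>s. lincomb (vec (y s)) a)"
    and w: "locally_determined (\<lambda>s. lincomb (\<lambda>k. lincomb (vec (z s)) (p s k)) a)" for a
    by (intro locally_determined_vector_of locally_determined_const assms)+
  have bound: "locally_determined (\<lambda>s. norm (f s) \<le> real (C s) * norm (g s))"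
    if "locally_determined f" "locally_determined g" for f g :: "_ \<Rightarrow> 'a"
    using locally_determined_comp2[OF that(1) locally_determined_comp2[OF assms(3) that(2), of "\<lambda>c g. real c * norm g"],
        of "\<lambda>f r. norm f \<le> r"] .
  show ?thesis
    unfolding coded_by_def dominates_def
    by (intro locally_refutable_conj locally_refutable_ball locally_refutable_if_determined bound v w)
qed

lemma embeds_cong_tail:
  assumes "y \<in> blocks" "z \<in> blocks" "y' \<in> blocks" "z' \<in> blocks"
    and "\<And>k. k \<ge> n \<Longrightarrow> y k = y' k" "\<And>k. k \<ge> n \<Longrightarrow> z k = z' k"
    and "embeds smul (closed_span smul e y) (closed_span smul e z)"
  shows "embeds smul (closed_span smul e y') (closed_span smul e z')"
proof (rule embeds_cong)
  show "isomorphic_subspaces smul (closed_span smul e y) (closed_span smul e y')"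
    "isomorphic_subspaces smul (closed_span smul e z) (closed_span smul e z')"
    using assms by (blast intro: closed_span_tail_invariant)+
qed (use assms(7) in \<open>auto simp: closed_span_eq subspace_cspan closed_cspan\<close>)

lemma embeds_closed_span_iff:
  assumes "y \<in> blocks"
  shows "embeds smul (closed_span smul e y) (closed_span smul e z) \<longleftrightarrow>
    (\<exists>C p. (\<forall>k. p k \<in> c00 Q) \<and> coded_by (vec y) (vec z) C p)"
  unfolding closed_span_eq by (rule embeds_iff_coded[OF block_coordinate_bounded[OF assms]])

lemma embeds_closed_span_if_coded:
  assumes "y \<in> blocks" "\<And>k. p k \<in> c00 Q" "coded_by (vec y) (vec z) C p"
  shows "embeds smul (closed_span smul e y) (closed_span smul e z)"
  using assms embeds_closed_span_iff by blast

text \<open>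
  A witness is one sequence: its entries carry the combinations \<open>p k\<close>, and the entry \<open>0\<close> also carries the
  constant.
\<close>

theorem Emb_meager_or_comeager:
  "meager_in pairs.pair_topology (Emb_rel smul e Q) \<or> comeager_in pairs.pair_topology (Emb_rel smul e Q)"
proof -
  let ?D = "UNIV \<times> c00 Q :: (nat \<times> (nat \<Rightarrow>\<^sub>0 'k)) set"
  define F where "F = {s \<in> (blocks \<times> blocks) \<times> (UNIV \<rightarrow> ?D).
    coded_by (vec (fst (fst s))) (vec (snd (fst s))) (fst (snd s 0)) (\<lambda>k. snd (snd s k))}"
  have "closedin (prod_topology pairs.pair_topology (product_topology (\<lambda>_. discrete_topology ?D) UNIV)) F"
    unfolding F_def
    by (intro pairs.closedin_locally_refutable locally_refutable_coded_by
        locally_determined_comp[where h = fst] locally_determined_comp[where h = snd]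
        locally_determined_coordinates)
  moreover have "Emb_rel smul e Q = fst ` F"
  proof (intro set_eqI iffI)
    fix x assume "x \<in> Emb_rel smul e Q"
    then have x: "x \<in> blocks \<times> blocks"
      and "fst x \<in> blocks" "embeds smul (closed_span smul e (fst x)) (closed_span smul e (snd x))"
      unfolding Emb_rel_def by auto
    then obtain C p where p: "\<And>k. p k \<in> c00 Q" "coded_by (vec (fst x)) (vec (snd x)) C p"
      using embeds_closed_span_iff by metis
    have "(x, \<lambda>k. (C, p k)) \<in> F"
      using x p by (auto simp: F_def)
    then show "x \<in> fst ` F" by force
  next
    fix x assume "x \<in> fst ` F"
    then obtain \<alpha> where "x \<in> blocks \<times> blocks" "\<And>k. snd (\<alpha> k) \<in> c00 Q"
        "coded_by (vec (fst x)) (vec (snd x)) (fst (\<alpha> 0)) (\<lambda>k. snd (\<alpha> k))"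
      unfolding F_def by (fastforce simp: Pi_def mem_Times_iff)
    then have "embeds smul (closed_span smul e (fst x)) (closed_span smul e (snd x))"
      by (intro embeds_closed_span_if_coded) auto
    with \<open>x \<in> blocks \<times> blocks\<close> show "x \<in> Emb_rel smul e Q"
      unfolding Emb_rel_def by auto
  qed
  moreover have "countable ?D"
    using countable_c00[OF countable_Q] by auto
  moreover have "y \<in> Emb_rel smul e Q"
    if "x \<in> Emb_rel smul e Q" "y \<in> blocks \<times> blocks" "\<And>k. k \<ge> n \<Longrightarrow> pairs.same_at k x y" for x y n
    using that embeds_cong_tail[of "fst x" "snd x" "fst y" "snd y" n]
    unfolding Emb_rel_def pairs.same_at_def by auto
  ultimately show ?thesis
    using pairs.zero_one_law by metis
qed

text \<open>
  A witness is a sequence of pairs, made of witnesses for the two embeddings.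
\<close>

theorem Be_meager_or_comeager:
  "meager_in pairs.pair_topology (Be_rel smul e Q) \<or> comeager_in pairs.pair_topology (Be_rel smul e Q)"
proof -
  let ?D = "(UNIV \<times> c00 Q) \<times> (UNIV \<times> c00 Q) :: ((nat \<times> (nat \<Rightarrow>\<^sub>0 'k)) \<times> (nat \<times> (nat \<Rightarrow>\<^sub>0 'k))) set"
  define F where "F = {s \<in> (blocks \<times> blocks) \<times> (UNIV \<rightarrow> ?D).
    coded_by (vec (fst (fst s))) (vec (snd (fst s))) (fst (fst (snd s 0))) (\<lambda>k. snd (fst (snd s k))) \<and>
    coded_by (vec (snd (fst s))) (vec (fst (fst s))) (fst (snd (snd s 0))) (\<lambda>k. snd (snd (snd s k)))}"
  have "closedin (prod_topology pairs.pair_topology (product_topology (\<lambda>_. discrete_topology ?D) UNIV)) F"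
    unfolding F_def
    by (intro pairs.closedin_locally_refutable locally_refutable_conj locally_refutable_coded_by
        locally_determined_comp[where h = "\<lambda>a. fst (fst a)"] locally_determined_comp[where h = "\<lambda>a. snd (fst a)"]
        locally_determined_comp[where h = "\<lambda>a. fst (snd a)"] locally_determined_comp[where h = "\<lambda>a. snd (snd a)"]
        locally_determined_coordinates)
  moreover have "Be_rel smul e Q = fst ` F"
  proof (intro set_eqI iffI)
    fix x assume "x \<in> Be_rel smul e Q"
    then have x: "x \<in> blocks \<times> blocks" "fst x \<in> blocks" "snd x \<in> blocks"
      and "embeds smul (closed_span smul e (fst x)) (closed_span smul e (snd x))"
        "embeds smul (closed_span smul e (snd x)) (closed_span smul e (fst x))"
      unfolding Be_rel_def by auto
    then obtain C p C' p' where p: "\<And>k. p k \<in> c00 Q" "coded_by (vec (fst x)) (vec (snd x)) C p"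
        "\<And>k. p' k \<in> c00 Q" "coded_by (vec (snd x)) (vec (fst x)) C' p'"
      using embeds_closed_span_iff by metis
    have "(x, \<lambda>k. ((C, p k), (C', p' k))) \<in> F"
      using x(1) p by (auto simp: F_def)
    then show "x \<in> fst ` F" by force
  next
    fix x assume "x \<in> fst ` F"
    then obtain \<alpha> where "x \<in> blocks \<times> blocks" "\<And>k. snd (fst (\<alpha> k)) \<in> c00 Q" "\<And>k. snd (snd (\<alpha> k)) \<in> c00 Q"
        "coded_by (vec (fst x)) (vec (snd x)) (fst (fst (\<alpha> 0))) (\<lambda>k. snd (fst (\<alpha> k)))"
        "coded_by (vec (snd x)) (vec (fst x)) (fst (snd (\<alpha> 0))) (\<lambda>k. snd (snd (\<alpha> k)))"
      unfolding F_def by (fastforce simp: Pi_def mem_Times_iff)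
    note \<alpha> = this
    have "embeds smul (closed_span smul e (fst x)) (closed_span smul e (snd x))"
      using \<alpha>(1,2,4) by (intro embeds_closed_span_if_coded) auto
    moreover have "embeds smul (closed_span smul e (snd x)) (closed_span smul e (fst x))"
      using \<alpha>(1,3,5) by (intro embeds_closed_span_if_coded) auto
    ultimately show "x \<in> Be_rel smul e Q"
      using \<alpha>(1) unfolding Be_rel_def by auto
  qed
  moreover have "countable ?D"
    using countable_c00[OF countable_Q] by auto
  moreover have "y \<in> Be_rel smul e Q"
    if "x \<in> Be_rel smul e Q" "y \<in> blocks \<times> blocks" "\<And>k. k \<ge> n \<Longrightarrow> pairs.same_at k x y" for x y n
    using that embeds_cong_tail[of "fst x" "snd x" "fst y" "snd y" n]
      embeds_cong_tail[of "snd x" "fst x" "snd y" "fst y" n]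
    unfolding Be_rel_def pairs.same_at_def by auto
  ultimately show ?thesis
    using pairs.zero_one_law by metis
qed

text \<open>
  The third components of a witness are the combinations that approximate the vectors of \<open>z\<close>.
\<close>

theorem Is_meager_or_comeager:
  "meager_in pairs.pair_topology (Is_rel smul e Q) \<or> comeager_in pairs.pair_topology (Is_rel smul e Q)"
proof -
  let ?D = "UNIV \<times> c00 Q \<times> c00 Q :: (nat \<times> (nat \<Rightarrow>\<^sub>0 'k) \<times> (nat \<Rightarrow>\<^sub>0 'k)) set"
  define p where "p s = (\<lambda>k. fst (snd (snd s k)))"
    for s :: "((nat \<Rightarrow> (nat \<Rightarrow>\<^sub>0 'k)) \<times> (nat \<Rightarrow> (nat \<Rightarrow>\<^sub>0 'k))) \<times> (nat \<Rightarrow> nat \<times> (nat \<Rightarrow>\<^sub>0 'k) \<times> (nat \<Rightarrow>\<^sub>0 'k))"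
  define P where "P s \<longleftrightarrow>
    coded_by (vec (fst (fst s))) (vec (snd (fst s))) (fst (snd s 0)) (p s) \<and>
    (\<forall>j m. dist (lincomb (\<lambda>k. lincomb (vec (snd (fst s))) (p s k)) (snd (snd (snd s (prod_encode (j, m))))))
      (lincomb e (snd (fst s) j)) \<le> 1 / real (Suc m))" for s
  define F where "F = {s \<in> (blocks \<times> blocks) \<times> (UNIV \<rightarrow> ?D). P s}"
  have p: "locally_determined (\<lambda>s. p s k)" for k
    unfolding p_def
    by (intro locally_determined_comp[where h = "\<lambda>a. fst (snd a)"] locally_determined_coordinates)
  have "locally_refutable P"
    unfolding P_def
    by (intro locally_refutable_conj locally_refutable_coded_by locally_refutable_all
        locally_refutable_if_determined p
        locally_determined_comp2[where h = "\<lambda>a b. dist a b \<le> 1 / real (Suc m)" for m]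
        locally_determined_vector_of locally_determined_const
        locally_determined_comp[where h = fst] locally_determined_comp[where h = "\<lambda>a. snd (snd a)"]
        locally_determined_coordinates)
  then have "closedin (prod_topology pairs.pair_topology (product_topology (\<lambda>_. discrete_topology ?D) UNIV)) F"
    unfolding F_def by (rule pairs.closedin_locally_refutable)
  moreover have "Is_rel smul e Q = fst ` F"
  proof (intro set_eqI iffI)
    fix x assume "x \<in> Is_rel smul e Q"
    then have x: "x \<in> blocks \<times> blocks"
      and "isomorphic_subspaces smul (cspan (vec (fst x))) (cspan (vec (snd x)))"
      unfolding Is_rel_def closed_span_eq by auto
    moreover have "fst x \<in> blocks" using x by auto
    ultimately obtain C r q where r: "\<And>k. r k \<in> c00 Q" "\<And>k. q k \<in> c00 Q"
        "coded_by (vec (fst x)) (vec (snd x)) C r"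
        "\<forall>j m. dist (lincomb (\<lambda>k. lincomb (vec (snd x)) (r k)) (q (prod_encode (j, m))))
          (lincomb e (snd x j)) \<le> 1 / real (Suc m)"
      using isomorphic_iff_coded[OF block_coordinate_bounded] by metis
    then have "(x, \<lambda>k. (C, r k, q k)) \<in> F"
      using x by (auto simp: F_def P_def p_def)
    then show "x \<in> fst ` F" by force
  next
    fix x assume "x \<in> fst ` F"
    then obtain \<alpha> where x: "x \<in> blocks \<times> blocks" and \<alpha>: "\<alpha> \<in> UNIV \<rightarrow> ?D" "P (x, \<alpha>)"
      unfolding F_def by auto
    have "\<forall>k. p (x, \<alpha>) k \<in> c00 Q" "\<forall>k. snd (snd (\<alpha> k)) \<in> c00 Q"
      using \<alpha>(1) unfolding p_def by (auto simp: Pi_def mem_Times_iff)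
    moreover have "fst x \<in> blocks" using x by auto
    ultimately have "isomorphic_subspaces smul (cspan (vec (fst x))) (cspan (vec (snd x)))"
      using \<alpha>(2) unfolding P_def isomorphic_iff_coded[OF block_coordinate_bounded[OF \<open>fst x \<in> blocks\<close>]]
      by (intro exI[of _ "fst (\<alpha> 0)"] exI[of _ "p (x, \<alpha>)"] exI[of _ "\<lambda>k. snd (snd (\<alpha> k))"]) simp
    then show "x \<in> Is_rel smul e Q"
      unfolding Is_rel_def closed_span_eq using x by auto
  qed
  moreover have "countable ?D"
    using countable_c00[OF countable_Q] by auto
  moreover have "y \<in> Is_rel smul e Q"
    if x: "x \<in> Is_rel smul e Q" and y: "y \<in> blocks \<times> blocks"
      and tail: "\<And>k. k \<ge> n \<Longrightarrow> pairs.same_at k x y" for x y n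
  proof -
    have "isomorphic_subspaces smul (closed_span smul e (fst y)) (closed_span smul e (fst x))"
      "isomorphic_subspaces smul (closed_span smul e (snd x)) (closed_span smul e (snd y))"
      using x y tail unfolding Is_rel_def pairs.same_at_def
      by (auto intro!: closed_span_tail_invariant[where n = n])
    moreover have "isomorphic_subspaces smul (closed_span smul e (fst x)) (closed_span smul e (snd x))"
      using x unfolding Is_rel_def by auto
    ultimately have "isomorphic_subspaces smul (closed_span smul e (fst y)) (closed_span smul e (snd y))"
      by (metis isomorphic_subspaces_trans)
    then show ?thesis
      using y unfolding Is_rel_def by auto
  qed
  ultimately show ?thesis
    using pairs.zero_one_law by metis
qed

theorem meager_or_comeager:
  "\<forall>R \<in> {Is_rel smul e Q, Be_rel smul e Q, Emb_rel smul e Q}.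
     meager_in (prod_topology (block_topology smul e Q) (block_topology smul e Q)) R \<or>
     comeager_in (prod_topology (block_topology smul e Q) (block_topology smul e Q)) R"
  unfolding pair_topology_eq
  using Is_meager_or_comeager Be_meager_or_comeager Emb_meager_or_comeager by blast

end

lemma block_space_real:
  assumes "schauder_basis scaleR e" "admissible_field scaleR e Q"
  shows "block_space scaleR e Q"
proof
  have Q: "countable Q" "\<rat> \<subseteq> Q"
    "\<And>a b. a \<in> Q \<Longrightarrow> b \<in> Q \<Longrightarrow> a + b \<in> Q" "\<And>a b. a \<in> Q \<Longrightarrow> b \<in> Q \<Longrightarrow> a * b \<in> Q"
    "\<And>a. a \<in> Q \<Longrightarrow> - a \<in> Q" "\<And>a. a \<in> Q \<Longrightarrow> inverse a \<in> Q"
    "\<And>x. x \<in> c00 Q \<Longrightarrow> of_real (norm (vector_of scaleR e x)) \<in> Q"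
    using assms(2) unfolding admissible_field_def by auto
  then show "countable Q" "0 \<in> Q" "1 \<in> Q"
    "\<And>a b. a \<in> Q \<Longrightarrow> b \<in> Q \<Longrightarrow> a + b \<in> Q" "\<And>a b. a \<in> Q \<Longrightarrow> b \<in> Q \<Longrightarrow> a * b \<in> Q"
    "\<And>a. a \<in> Q \<Longrightarrow> - a \<in> Q" "\<And>a. a \<in> Q \<Longrightarrow> inverse a \<in> Q"
    "\<And>x. x \<in> c00 Q \<Longrightarrow> of_real (norm (vector_of scaleR e x)) \<in> Q"
    by auto
  show "closure Q = UNIV"
    using closure_mono[OF Q(2)] Rats_closure_real by auto
qed (use assms(1) in \<open>auto simp: scaleR_right_distrib scaleR_left_distrib\<close>)

lemma block_space_complex:
  assumes "complex_banach scaleC" "schauder_basis scaleC f" "admissible_field scaleC f K" "\<i> \<in> K"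
  shows "block_space scaleC f K"
proof -
  interpret vector_space scaleC
    using assms(1) by (simp add: complex_banach_def)
  show ?thesis
  proof
    have Q: "countable K" "\<rat> \<subseteq> K"
      "\<And>a b. a \<in> K \<Longrightarrow> b \<in> K \<Longrightarrow> a + b \<in> K" "\<And>a b. a \<in> K \<Longrightarrow> b \<in> K \<Longrightarrow> a * b \<in> K"
      "\<And>a. a \<in> K \<Longrightarrow> - a \<in> K" "\<And>a. a \<in> K \<Longrightarrow> inverse a \<in> K"
      "\<And>x. x \<in> c00 K \<Longrightarrow> of_real (norm (vector_of scaleC f x)) \<in> K"
      using assms(3) unfolding admissible_field_def by auto
    then show "countable K" "0 \<in> K" "1 \<in> K"
      "\<And>a b. a \<in> K \<Longrightarrow> b \<in> K \<Longrightarrow> a + b \<in> K" "\<And>a b. a \<in> K \<Longrightarrow> b \<in> K \<Longrightarrow> a * b \<in> K"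
      "\<And>a. a \<in> K \<Longrightarrow> - a \<in> K" "\<And>a. a \<in> K \<Longrightarrow> inverse a \<in> K"
      "\<And>x. x \<in> c00 K \<Longrightarrow> of_real (norm (vector_of scaleC f x)) \<in> K"
      by auto
    have "z \<in> closure K" for z
    proof -
      have "\<exists>q. (\<forall>n. q n \<in> \<rat>) \<and> q \<longlonglongrightarrow> r" for r :: real
        using closure_sequential[of r \<rat>] Rats_closure_real by auto
      then obtain a b where ab: "\<And>n. a n \<in> \<rat>" "a \<longlonglongrightarrow> Re z" "\<And>n. b n \<in> \<rat>" "b \<longlonglongrightarrow> Im z"
        by metis
      have real_in_K: "of_real q \<in> K" if "q \<in> \<rat>" for q :: real
        using that Q(2) by (elim Rats_cases) (auto simp: subset_iff)
      have "of_real (a n) + \<i> * of_real (b n) \<in> K" for n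
        by (intro Q(3,4) assms(4) real_in_K ab)
      moreover have "(\<lambda>n. of_real (a n) + \<i> * of_real (b n)) \<longlonglongrightarrow> of_real (Re z) + \<i> * of_real (Im z)"
        by (intro tendsto_intros ab)
      ultimately show ?thesis
        unfolding closure_sequential complex_eq[symmetric]
        by (intro exI[of _ "\<lambda>n. of_real (a n) + \<i> * of_real (b n)"]) simp
    qed
    then show "closure K = UNIV" by blast
  qed (use assms(1,2) in \<open>auto simp: complex_banach_def\<close>)
qed

theorem theorem4p1:
  fixes e :: "nat \<Rightarrow> 'a::banach" and Q :: "real set"
    and scaleC :: "complex \<Rightarrow> 'b::banach \<Rightarrow> 'b" and f :: "nat \<Rightarrow> 'b" and K :: "complex set"
  shows "(schauder_basis scaleR e \<and> admissible_field scaleR e Q \<longrightarrow>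
            (\<forall>R \<in> {Is_rel scaleR e Q, Be_rel scaleR e Q, Emb_rel scaleR e Q}.
               meager_in (prod_topology (block_topology scaleR e Q) (block_topology scaleR e Q)) R \<or>
               comeager_in (prod_topology (block_topology scaleR e Q) (block_topology scaleR e Q)) R))
       \<and> (complex_banach scaleC \<and> schauder_basis scaleC f \<and>
            admissible_field scaleC f K \<and> \<i> \<in> K \<longrightarrow>
            (\<forall>R \<in> {Is_rel scaleC f K, Be_rel scaleC f K, Emb_rel scaleC f K}.
               meager_in (prod_topology (block_topology scaleC f K) (block_topology scaleC f K)) R \<or>
               comeager_in (prod_topology (block_topology scaleC f K) (block_topology scaleC f K)) R))"
  using block_space.meager_or_comeager[OF block_space_real]
    block_space.meager_or_comeager[OF block_space_complex] by blast

end
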